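(* Let $\mathcal{C}$ be a locally semiadditive and compositionally distributive 2-category. For a pair of objects $A$ and $B$ of $\mathcal{C}$, the following conditions are equivalent: 1. the weak 2-product $(P, p_A, p_B)$ of $A, B$ exists; 2. the weak 2-coproduct $(P, i_A, i_B)$ of $A, B$ exists; 3. the weak 2-biproduct $(P, p_A, p_B, i_A, i_B, \theta_A, \theta_B, \theta_{AB}, \theta_{BA}, \theta_P)$ of $A, B$ exists.
   Context: A 2-category means a strict 2-category. Horizontal composition is written by juxtaposition, vertical composition of 2-morphisms by $\odot$; whiskering of a 2-morphism $\alpha$ by a 1-morphism $f$ is written $f\alpha$ or $\alpha f$. Locally semiadditive: every Hom-category $Hom(X,Y)$ is semiadditive, i.e. has finite biproducts. Biproducts of 1-morphisms are written $\oplus$, with projection and injection 2-morphisms $\pi,\nu$; the induced addition of parallel 2-morphisms is $+$; $0_{Y,X}$ denotes the zero object of $Hom(X,Y)$ (zero 1-morphism $X\to Y$). Compositionally distributive: 2-morphisms distribute over addition of 2-morphisms, i.e. $\gamma(\alpha+\beta)=\gamma\alpha+\gamma\beta$, $(\alpha+\beta)\gamma=\alpha\gamma+\beta\gamma$ (horizontal composition) and $\alpha\odot(\beta+\gamma)=\alpha\odot\beta+\alpha\odot\gamma$ whenever the composites are defined. Weak 2-product of $A,B$: an object $P$ with 1-morphisms $p_A:P\to A$, $p_B:P\to B$ such that: (i) for every object $X$ with 1-morphisms $f:X\to A$, $g:X\to B$ there exist a 1-morphism $b:X\to P$ and 2-isomorphisms $\xi_A:p_Ab\Rightarrow f$, $\xi_B:p_Bb\Rightarrow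 g$; (ii) for any other such cone $f':X\to A$, $g':X\to B$ with corresponding $b':X\to P$ and 2-isomorphisms $\xi'_A:p_Ab'\Rightarrow f'$, $\xi'_B:p_Bb'\Rightarrow g'$, and any 2-morphisms $\Sigma_A:f\Rightarrow f'$, $\Sigma_B:g\Rightarrow g'$, there is a unique 2-morphism $\gamma:b\Rightarrow b'$ with $p_A\gamma=(\xi'_A)^{-1}\odot\Sigma_A\odot\xi_A$ and $p_B\gamma=(\xi'_B)^{-1}\odot\Sigma_B\odot\xi_B$. Weak 2-coproduct of $A,B$: the dual notion, an object $P$ with 1-morphisms $i_A:A\to P$, $i_B:B\to P$ having the same universal property with all 1-morphisms reversed. Weak 2-biproduct of $A,B$: a tuple $(P,p_A,p_B,i_A,i_B,\theta_A,\theta_B,\theta_{AB},\theta_{BA},\theta_P)$ with 1-morphisms $p_A:P\to A$, $p_B:P\to B$, $i_A:A\to P$, $i_B:B\to P$ and 2-isomorphisms $\theta_A:p_Ai_A\Rightarrow id_A$, $\theta_B:p_Bi_B\Rightarrow id_B$, $\theta_{BA}:p_Bi_A\Rightarrow 0_{B,A}$, $\theta_{AB}:p_Ai_B\Rightarrow 0_{A,B}$, $\theta_P:i_Ap_A\oplus i_Bp_B\Rightarrow id_P$, satisfying $$p_A\theta_Pi_A=\begin{bmatrix}(p_Ai_A)\theta_A&0\\0&0\end{bmatrix},\qquad p_B\theta_Pi_B=\begin{bmatrix}0&0\\0&(p_Bi_B)\theta_B\end{bmatrix}.$$ Here the matrices are taken with respect to the decompositions of the sources $p_A(i_Ap_A\oplus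 i_Bp_B)i_A\cong p_Ai_Ap_Ai_A\oplus p_Ai_Bp_Bi_A$ and $p_B(i_Ap_A\oplus i_Bp_B)i_B\cong p_Bi_Ap_Ai_B\oplus p_Bi_Bp_Bi_B$, and of the targets $p_Ai_A\cong p_Ai_A\oplus 0$ and $p_Bi_B\cong 0\oplus p_Bi_B$; that is, $p_A\theta_Pi_A=((p_Ai_A)\theta_A)\odot(p_A\pi_1i_A)$ and $p_B\theta_Pi_B=((p_Bi_B)\theta_B)\odot(p_B\pi_2i_B)$, where $\pi_1,\pi_2$ are the projections of $i_Ap_A\oplus i_Bp_B$ onto $i_Ap_A$ and $i_Bp_B$.
   Formalization: Compositional distributivity here also requires that horizontal composition with a zero 2-morphism is zero (the empty sum); with only the displayed binary laws the equivalence fails, e.g. for Boolean matrices under block sum seen as a one-object 2-category. *)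

theory Defs
  imports Main
begin

section \<open>Categories\<close>

record ('o, 'm) cat =
  Ob :: "'o set"
  Ar :: "'m set"
  Dom :: "'m \<Rightarrow> 'o"
  Cod :: "'m \<Rightarrow> 'o"
  Id :: "'o \<Rightarrow> 'm"
  Comp :: "'m \<Rightarrow> 'm \<Rightarrow> 'm"  (infixr "\<cdot>\<index>" 70)

definition Hom :: "('o, 'm) cat \<Rightarrow> 'o \<Rightarrow> 'o \<Rightarrow> 'm set" where
  "Hom K a b = {f \<in> Ar K. Dom K f = a \<and> Cod K f = b}"

locale category =
  fixes K :: "('o, 'm) cat" (structure)
  assumes Dom_in: "f \<in> Ar K \<Longrightarrow> Dom K f \<in> Ob K"
    and Cod_in: "f \<in> Ar K \<Longrightarrow> Cod K f \<in> Ob K"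
    and Id_in: "a \<in> Ob K \<Longrightarrow> Id K a \<in> Hom K a a"
    and Comp_in: "\<lbrakk>f \<in> Hom K a b; g \<in> Hom K b c\<rbrakk> \<Longrightarrow> g \<cdot> f \<in> Hom K a c"
    and Id_left: "f \<in> Hom K a b \<Longrightarrow> Id K b \<cdot> f = f"
    and Id_right: "f \<in> Hom K a b \<Longrightarrow> f \<cdot> Id K a = f"
    and Comp_assoc: "\<lbrakk>f \<in> Hom K a b; g \<in> Hom K b c; h \<in> Hom K c d\<rbrakk>
      \<Longrightarrow> (h \<cdot> g) \<cdot> f = h \<cdot> (g \<cdot> f)"

definition op_cat :: "('o, 'm) cat \<Rightarrow> ('o, 'm) cat" where
  "op_cat K = \<lparr>Ob = Ob K, Ar = Ar K, Dom = Cod K, Cod = Dom K, Id = Id K,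
     Comp = (\<lambda>g f. Comp K f g)\<rparr>"

definition inverses :: "('o, 'm) cat \<Rightarrow> 'm \<Rightarrow> 'm \<Rightarrow> bool" where
  "inverses K f g \<longleftrightarrow> f \<in> Ar K \<and> g \<in> Hom K (Cod K f) (Dom K f) \<and>
     g \<cdot>\<^bsub>K\<^esub> f = Id K (Dom K f) \<and> f \<cdot>\<^bsub>K\<^esub> g = Id K (Cod K f)"

definition Isos :: "('o, 'm) cat \<Rightarrow> 'o \<Rightarrow> 'o \<Rightarrow> 'm set" where
  "Isos K a b = {f \<in> Hom K a b. \<exists>g. inverses K f g}"

definition inverse_of :: "('o, 'm) cat \<Rightarrow> 'm \<Rightarrow> 'm" where
  "inverse_of K f = (THE g. inverses K f g)"

section \<open>Semiadditive categories\<close>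

definition is_zero_ob :: "('o, 'm) cat \<Rightarrow> 'o \<Rightarrow> bool" where
  "is_zero_ob K z \<longleftrightarrow> z \<in> Ob K \<and>
     (\<forall>a \<in> Ob K. (\<exists>!f. f \<in> Hom K a z) \<and> (\<exists>!f. f \<in> Hom K z a))"

definition zero_ob :: "('o, 'm) cat \<Rightarrow> 'o" where
  "zero_ob K = (SOME z. is_zero_ob K z)"

definition zero_mor :: "('o, 'm) cat \<Rightarrow> 'o \<Rightarrow> 'o \<Rightarrow> 'm" where
  "zero_mor K a b =
     (THE g. g \<in> Hom K (zero_ob K) b) \<cdot>\<^bsub>K\<^esub> (THE f. f \<in> Hom K a (zero_ob K))"

definition is_product :: "('o, 'm) cat \<Rightarrow> 'o \<Rightarrow> 'o \<Rightarrow> 'o \<Rightarrow> 'm \<Rightarrow> 'm \<Rightarrow> bool" where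
  "is_product K a b s p q \<longleftrightarrow> s \<in> Ob K \<and> p \<in> Hom K s a \<and> q \<in> Hom K s b \<and>
     (\<forall>x \<in> Ob K. \<forall>f \<in> Hom K x a. \<forall>g \<in> Hom K x b.
        \<exists>!h. h \<in> Hom K x s \<and> p \<cdot>\<^bsub>K\<^esub> h = f \<and> q \<cdot>\<^bsub>K\<^esub> h = g)"

definition is_coproduct :: "('o, 'm) cat \<Rightarrow> 'o \<Rightarrow> 'o \<Rightarrow> 'o \<Rightarrow> 'm \<Rightarrow> 'm \<Rightarrow> bool" where
  "is_coproduct K a b s i j \<longleftrightarrow> s \<in> Ob K \<and> i \<in> Hom K a s \<and> j \<in> Hom K b s \<and>
     (\<forall>x \<in> Ob K. \<forall>f \<in> Hom K a x. \<forall>g \<in> Hom K b x.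
        \<exists>!h. h \<in> Hom K s x \<and> h \<cdot>\<^bsub>K\<^esub> i = f \<and> h \<cdot>\<^bsub>K\<^esub> j = g)"

record ('o, 'm) biprod_data =
  Sum :: 'o
  Pr1 :: 'm
  Pr2 :: 'm
  In1 :: 'm
  In2 :: 'm

definition is_biproduct :: "('o, 'm) cat \<Rightarrow> 'o \<Rightarrow> 'o \<Rightarrow> ('o, 'm) biprod_data \<Rightarrow> bool" where
  "is_biproduct K a b S \<longleftrightarrow>
     is_product K a b (Sum S) (Pr1 S) (Pr2 S) \<and>
     is_coproduct K a b (Sum S) (In1 S) (In2 S) \<and>
     Pr1 S \<cdot>\<^bsub>K\<^esub> In1 S = Id K a \<and> Pr2 S \<cdot>\<^bsub>K\<^esub> In2 S = Id K b \<and>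
     Pr2 S \<cdot>\<^bsub>K\<^esub> In1 S = zero_mor K a b \<and> Pr1 S \<cdot>\<^bsub>K\<^esub> In2 S = zero_mor K b a"

definition biprod :: "('o, 'm) cat \<Rightarrow> 'o \<Rightarrow> 'o \<Rightarrow> ('o, 'm) biprod_data" where
  "biprod K a b = (SOME S. is_biproduct K a b S)"

definition semiadditive :: "('o, 'm) cat \<Rightarrow> bool" where
  "semiadditive K \<longleftrightarrow> category K \<and> (\<exists>z. is_zero_ob K z) \<and>
     (\<forall>a \<in> Ob K. \<forall>b \<in> Ob K. \<exists>S. is_biproduct K a b S)"

text \<open>For parallel \<open>f, g : a \<rightarrow> b\<close>, the induced sum is the composite of the diagonal
  \<open>a \<rightarrow> a \<oplus> a\<close> with the copairing \<open>a \<oplus> a \<rightarrow> b\<close> of \<open>f\<close> and \<open>g\<close>.\<close>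

definition add_mor :: "('o, 'm) cat \<Rightarrow> 'm \<Rightarrow> 'm \<Rightarrow> 'm" where
  "add_mor K f g =
     (let a = Dom K f; b = Cod K f; S = biprod K a a;
          d = (THE d. d \<in> Hom K a (Sum S) \<and> Pr1 S \<cdot>\<^bsub>K\<^esub> d = Id K a \<and> Pr2 S \<cdot>\<^bsub>K\<^esub> d = Id K a);
          c = (THE c. c \<in> Hom K (Sum S) b \<and> c \<cdot>\<^bsub>K\<^esub> In1 S = f \<and> c \<cdot>\<^bsub>K\<^esub> In2 S = g)
      in c \<cdot>\<^bsub>K\<^esub> d)"

section \<open>Strict 2-categories\<close>

text \<open>\<open>One\<close> is the category of objects and 1-morphisms; \<open>Vert\<close> has the 1-morphisms as objects
  and the 2-morphisms as arrows, under vertical composition; \<open>HComp \<beta> \<alpha>\<close> is the horizontal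
  composite \<open>\<beta>\<alpha>\<close>, where \<open>\<alpha>\<close> is applied first.\<close>

record ('o, 'm, 'c) two_cat =
  One :: "('o, 'm) cat"
  Vert :: "('m, 'c) cat"
  HComp :: "'c \<Rightarrow> 'c \<Rightarrow> 'c"  (infixr "\<diamondop>\<index>" 75)

abbreviation Obj :: "('o, 'm, 'c) two_cat \<Rightarrow> 'o set" where
  "Obj C \<equiv> Ob (One C)"

abbreviation Hom1 :: "('o, 'm, 'c) two_cat \<Rightarrow> 'o \<Rightarrow> 'o \<Rightarrow> 'm set" where
  "Hom1 C \<equiv> Hom (One C)"

abbreviation Hom2 :: "('o, 'm, 'c) two_cat \<Rightarrow> 'm \<Rightarrow> 'm \<Rightarrow> 'c set" where
  "Hom2 C \<equiv> Hom (Vert C)"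

abbreviation Iso2 :: "('o, 'm, 'c) two_cat \<Rightarrow> 'm \<Rightarrow> 'm \<Rightarrow> 'c set" where
  "Iso2 C \<equiv> Isos (Vert C)"

abbreviation inv2 :: "('o, 'm, 'c) two_cat \<Rightarrow> 'c \<Rightarrow> 'c" where
  "inv2 C \<equiv> inverse_of (Vert C)"

abbreviation comp1 :: "('o, 'm, 'c) two_cat \<Rightarrow> 'm \<Rightarrow> 'm \<Rightarrow> 'm"  (infixr "\<bullet>\<index>" 75) where
  "g \<bullet>\<^bsub>C\<^esub> f \<equiv> Comp (One C) g f"

abbreviation vcomp :: "('o, 'm, 'c) two_cat \<Rightarrow> 'c \<Rightarrow> 'c \<Rightarrow> 'c"  (infixr "\<odot>\<index>" 65) where
  "\<beta> \<odot>\<^bsub>C\<^esub> \<alpha> \<equiv> Comp (Vert C) \<beta> \<alpha>"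

abbreviation lwhisk :: "('o, 'm, 'c) two_cat \<Rightarrow> 'm \<Rightarrow> 'c \<Rightarrow> 'c"  (infixr "\<rhd>\<index>" 75) where
  "f \<rhd>\<^bsub>C\<^esub> \<alpha> \<equiv> Id (Vert C) f \<diamondop>\<^bsub>C\<^esub> \<alpha>"

abbreviation rwhisk :: "('o, 'm, 'c) two_cat \<Rightarrow> 'c \<Rightarrow> 'm \<Rightarrow> 'c"  (infixl "\<lhd>\<index>" 76) where
  "\<alpha> \<lhd>\<^bsub>C\<^esub> f \<equiv> \<alpha> \<diamondop>\<^bsub>C\<^esub> Id (Vert C) f"

definition horiz :: "('o, 'm, 'c) two_cat \<Rightarrow> ('o, 'c) cat" where
  "horiz C = \<lparr>Ob = Obj C, Ar = Ar (Vert C),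
     Dom = (\<lambda>\<alpha>. Dom (One C) (Dom (Vert C) \<alpha>)),
     Cod = (\<lambda>\<alpha>. Cod (One C) (Dom (Vert C) \<alpha>)),
     Id = (\<lambda>X. Id (Vert C) (Id (One C) X)),
     Comp = HComp C\<rparr>"

locale two_category =
  fixes C :: "('o, 'm, 'c) two_cat" (structure)
  assumes category_One: "category (One C)"
    and category_Vert: "category (Vert C)"
    and category_horiz: "category (horiz C)"
    and Ob_Vert: "Ob (Vert C) = Ar (One C)"
    and globular: "\<alpha> \<in> Hom2 C f g \<Longrightarrow>
      Dom (One C) f = Dom (One C) g \<and> Cod (One C) f = Cod (One C) g"
    and HComp_in: "\<lbrakk>f \<in> Hom1 C X Y; g \<in> Hom1 C Y Z; \<alpha> \<in> Hom2 C f f'; \<beta> \<in> Hom2 C g g'\<rbrakk>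
      \<Longrightarrow> \<beta> \<diamondop> \<alpha> \<in> Hom2 C (g \<bullet> f) (g' \<bullet> f')"
    and HComp_Id: "\<lbrakk>f \<in> Hom1 C X Y; g \<in> Hom1 C Y Z\<rbrakk>
      \<Longrightarrow> Id (Vert C) g \<diamondop> Id (Vert C) f = Id (Vert C) (g \<bullet> f)"
    and interchange: "\<lbrakk>f \<in> Hom1 C X Y; g \<in> Hom1 C Y Z;
        \<alpha> \<in> Hom2 C f f'; \<alpha>' \<in> Hom2 C f' f''; \<beta> \<in> Hom2 C g g'; \<beta>' \<in> Hom2 C g' g''\<rbrakk>
      \<Longrightarrow> (\<beta>' \<odot> \<beta>) \<diamondop> (\<alpha>' \<odot> \<alpha>) = (\<beta>' \<diamondop> \<alpha>') \<odot> (\<beta> \<diamondop> \<alpha>)"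

text \<open>The dual obtained by reversing 1-morphisms but not 2-morphisms.\<close>

definition op_two_cat :: "('o, 'm, 'c) two_cat \<Rightarrow> ('o, 'm, 'c) two_cat" where
  "op_two_cat C = \<lparr>One = op_cat (One C), Vert = Vert C, HComp = (\<lambda>\<beta> \<alpha>. HComp C \<alpha> \<beta>)\<rparr>"

definition hom_cat :: "('o, 'm, 'c) two_cat \<Rightarrow> 'o \<Rightarrow> 'o \<Rightarrow> ('m, 'c) cat" where
  "hom_cat C X Y = \<lparr>Ob = Hom1 C X Y,
     Ar = {\<alpha> \<in> Ar (Vert C). Dom (Vert C) \<alpha> \<in> Hom1 C X Y \<and> Cod (Vert C) \<alpha> \<in> Hom1 C X Y},
     Dom = Dom (Vert C), Cod = Cod (Vert C), Id = Id (Vert C), Comp = Comp (Vert C)\<rparr>"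

section \<open>Locally semiadditive, compositionally distributive 2-categories\<close>

definition locally_semiadditive :: "('o, 'm, 'c) two_cat \<Rightarrow> bool" where
  "locally_semiadditive C \<longleftrightarrow>
     (\<forall>X \<in> Obj C. \<forall>Y \<in> Obj C. semiadditive (hom_cat C X Y))"

text \<open>The arguments are in the order of the subscripts of \<open>0\<^bsub>Y,X\<^esub> : X \<rightarrow> Y\<close>.\<close>

definition zero1 :: "('o, 'm, 'c) two_cat \<Rightarrow> 'o \<Rightarrow> 'o \<Rightarrow> 'm" where
  "zero1 C Y X = zero_ob (hom_cat C X Y)"

definition biprod1 :: "('o, 'm, 'c) two_cat \<Rightarrow> 'm \<Rightarrow> 'm \<Rightarrow> ('m, 'c) biprod_data" where
  "biprod1 C f g = biprod (hom_cat C (Dom (One C) f) (Cod (One C) f)) f g"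

definition zero2 :: "('o, 'm, 'c) two_cat \<Rightarrow> 'm \<Rightarrow> 'm \<Rightarrow> 'c" where
  "zero2 C f g = zero_mor (hom_cat C (Dom (One C) f) (Cod (One C) f)) f g"

definition add2 :: "('o, 'm, 'c) two_cat \<Rightarrow> 'c \<Rightarrow> 'c \<Rightarrow> 'c"  (infixl "\<boxplus>\<index>" 60) where
  "\<alpha> \<boxplus>\<^bsub>C\<^esub> \<beta> = add_mor (hom_cat C (Dom (One C) (Dom (Vert C) \<alpha>)) (Cod (One C) (Dom (Vert C) \<alpha>))) \<alpha> \<beta>"

text \<open>Distributivity of horizontal composition is over finite sums of 2-morphisms, including the
  empty sum. The nullary case does not follow from the binary one when addition is not cancellative:
  for a strictly monoidal skeleton of the Boolean matrices under \<open>\<oplus>\<close>, regarded as a 2-category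
  with one object, the binary laws hold but whiskering preserves neither zero 2-morphisms nor
  biproducts. In particular it would not give the decomposition
  \<open>p(f \<oplus> g)i \<cong> pfi \<oplus> pgi\<close> that underlies matrix notation. For vertical composition the nullary case is
  automatic.\<close>

definition compositionally_distributive :: "('o, 'm, 'c) two_cat \<Rightarrow> bool" where
  "compositionally_distributive C \<longleftrightarrow>
     (\<forall>X Y Z f g h k \<alpha> \<beta> \<gamma>.
        f \<in> Hom1 C X Y \<and> h \<in> Hom1 C Y Z \<and>
        \<alpha> \<in> Hom2 C f g \<and> \<beta> \<in> Hom2 C f g \<and> \<gamma> \<in> Hom2 C h k \<longrightarrow>
        \<gamma> \<diamondop>\<^bsub>C\<^esub> (\<alpha> \<boxplus>\<^bsub>C\<^esub> \<beta>) = (\<gamma> \<diamondop>\<^bsub>C\<^esub> \<alpha>) \<boxplus>\<^bsub>C\<^esub> (\<gamma> \<diamondop>\<^bsub>C\<^esub> \<beta>)) \<and>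
     (\<forall>X Y Z f g h k \<alpha> \<beta> \<gamma>.
        h \<in> Hom1 C X Y \<and> f \<in> Hom1 C Y Z \<and>
        \<alpha> \<in> Hom2 C f g \<and> \<beta> \<in> Hom2 C f g \<and> \<gamma> \<in> Hom2 C h k \<longrightarrow>
        (\<alpha> \<boxplus>\<^bsub>C\<^esub> \<beta>) \<diamondop>\<^bsub>C\<^esub> \<gamma> = (\<alpha> \<diamondop>\<^bsub>C\<^esub> \<gamma>) \<boxplus>\<^bsub>C\<^esub> (\<beta> \<diamondop>\<^bsub>C\<^esub> \<gamma>)) \<and>
     (\<forall>f g h \<alpha> \<beta> \<gamma>.
        \<alpha> \<in> Hom2 C g h \<and> \<beta> \<in> Hom2 C f g \<and> \<gamma> \<in> Hom2 C f g \<longrightarrow>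
        \<alpha> \<odot>\<^bsub>C\<^esub> (\<beta> \<boxplus>\<^bsub>C\<^esub> \<gamma>) = (\<alpha> \<odot>\<^bsub>C\<^esub> \<beta>) \<boxplus>\<^bsub>C\<^esub> (\<alpha> \<odot>\<^bsub>C\<^esub> \<gamma>)) \<and>
     (\<forall>X Y Z f g h k \<gamma>.
        f \<in> Hom1 C X Y \<and> g \<in> Hom1 C X Y \<and> h \<in> Hom1 C Y Z \<and> \<gamma> \<in> Hom2 C h k \<longrightarrow>
        \<gamma> \<diamondop>\<^bsub>C\<^esub> zero2 C f g = zero2 C (h \<bullet>\<^bsub>C\<^esub> f) (k \<bullet>\<^bsub>C\<^esub> g)) \<and>
     (\<forall>X Y Z f g h k \<gamma>.
        h \<in> Hom1 C X Y \<and> f \<in> Hom1 C Y Z \<and> g \<in> Hom1 C Y Z \<and> \<gamma> \<in> Hom2 C h k \<longrightarrow>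
        zero2 C f g \<diamondop>\<^bsub>C\<^esub> \<gamma> = zero2 C (f \<bullet>\<^bsub>C\<^esub> h) (g \<bullet>\<^bsub>C\<^esub> k))"

section \<open>Weak 2-products, 2-coproducts and 2-biproducts\<close>

definition weak_cone ::
    "('o, 'm, 'c) two_cat \<Rightarrow> 'o \<Rightarrow> 'o \<Rightarrow> 'o \<Rightarrow> 'm \<Rightarrow> 'm \<Rightarrow> 'o \<Rightarrow> 'm \<Rightarrow> 'm \<Rightarrow> 'm \<Rightarrow> 'c \<Rightarrow> 'c \<Rightarrow> bool" where
  "weak_cone C A B P pA pB X f g b \<xi>A \<xi>B \<longleftrightarrow>
     f \<in> Hom1 C X A \<and> g \<in> Hom1 C X B \<and> b \<in> Hom1 C X P \<and>
     \<xi>A \<in> Iso2 C (pA \<bullet>\<^bsub>C\<^esub> b) f \<and> \<xi>B \<in> Iso2 C (pB \<bullet>\<^bsub>C\<^esub> b) g"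

definition weak_2product ::
    "('o, 'm, 'c) two_cat \<Rightarrow> 'o \<Rightarrow> 'o \<Rightarrow> 'o \<Rightarrow> 'm \<Rightarrow> 'm \<Rightarrow> bool" where
  "weak_2product C A B P pA pB \<longleftrightarrow>
     P \<in> Obj C \<and> pA \<in> Hom1 C P A \<and> pB \<in> Hom1 C P B \<and>
     (\<forall>X \<in> Obj C. \<forall>f \<in> Hom1 C X A. \<forall>g \<in> Hom1 C X B.
        \<exists>b \<xi>A \<xi>B. weak_cone C A B P pA pB X f g b \<xi>A \<xi>B) \<and>
     (\<forall>X \<in> Obj C. \<forall>f g b \<xi>A \<xi>B f' g' b' \<xi>A' \<xi>B' \<Sigma>A \<Sigma>B.
        weak_cone C A B P pA pB X f g b \<xi>A \<xi>B \<and>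
        weak_cone C A B P pA pB X f' g' b' \<xi>A' \<xi>B' \<and>
        \<Sigma>A \<in> Hom2 C f f' \<and> \<Sigma>B \<in> Hom2 C g g' \<longrightarrow>
        (\<exists>!\<gamma>. \<gamma> \<in> Hom2 C b b' \<and>
           pA \<rhd>\<^bsub>C\<^esub> \<gamma> = inv2 C \<xi>A' \<odot>\<^bsub>C\<^esub> \<Sigma>A \<odot>\<^bsub>C\<^esub> \<xi>A \<and>
           pB \<rhd>\<^bsub>C\<^esub> \<gamma> = inv2 C \<xi>B' \<odot>\<^bsub>C\<^esub> \<Sigma>B \<odot>\<^bsub>C\<^esub> \<xi>B))"

definition weak_2coproduct ::
    "('o, 'm, 'c) two_cat \<Rightarrow> 'o \<Rightarrow> 'o \<Rightarrow> 'o \<Rightarrow> 'm \<Rightarrow> 'm \<Rightarrow> bool" where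
  "weak_2coproduct C A B P iA iB \<longleftrightarrow> weak_2product (op_two_cat C) A B P iA iB"

text \<open>In the last two conditions \<open>\<pi>\<^sub>1\<close> and \<open>\<pi>\<^sub>2\<close> are the projections of \<open>i\<^sub>A p\<^sub>A \<oplus> i\<^sub>B p\<^sub>B\<close>; they express
  that \<open>p\<^sub>A \<theta>\<^sub>P i\<^sub>A\<close> and \<open>p\<^sub>B \<theta>\<^sub>P i\<^sub>B\<close> are given by matrices whose only nonzero entries are the diagonal
  entries \<open>(p\<^sub>A i\<^sub>A)\<theta>\<^sub>A\<close> and \<open>(p\<^sub>B i\<^sub>B)\<theta>\<^sub>B\<close>, respectively.\<close>

definition weak_2biproduct ::
    "('o, 'm, 'c) two_cat \<Rightarrow> 'o \<Rightarrow> 'o \<Rightarrow> 'o \<Rightarrow> 'm \<Rightarrow> 'm \<Rightarrow> 'm \<Rightarrow> 'm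
      \<Rightarrow> 'c \<Rightarrow> 'c \<Rightarrow> 'c \<Rightarrow> 'c \<Rightarrow> 'c \<Rightarrow> bool" where
  "weak_2biproduct C A B P pA pB iA iB \<theta>A \<theta>B \<theta>AB \<theta>BA \<theta>P \<longleftrightarrow>
     (let S = biprod1 C (iA \<bullet>\<^bsub>C\<^esub> pA) (iB \<bullet>\<^bsub>C\<^esub> pB) in
       P \<in> Obj C \<and>
       pA \<in> Hom1 C P A \<and> pB \<in> Hom1 C P B \<and> iA \<in> Hom1 C A P \<and> iB \<in> Hom1 C B P \<and>
       \<theta>A \<in> Iso2 C (pA \<bullet>\<^bsub>C\<^esub> iA) (Id (One C) A) \<and>
       \<theta>B \<in> Iso2 C (pB \<bullet>\<^bsub>C\<^esub> iB) (Id (One C) B) \<and>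
       \<theta>BA \<in> Iso2 C (pB \<bullet>\<^bsub>C\<^esub> iA) (zero1 C B A) \<and>
       \<theta>AB \<in> Iso2 C (pA \<bullet>\<^bsub>C\<^esub> iB) (zero1 C A B) \<and>
       \<theta>P \<in> Iso2 C (Sum S) (Id (One C) P) \<and>
       pA \<rhd>\<^bsub>C\<^esub> \<theta>P \<lhd>\<^bsub>C\<^esub> iA = ((pA \<bullet>\<^bsub>C\<^esub> iA) \<rhd>\<^bsub>C\<^esub> \<theta>A) \<odot>\<^bsub>C\<^esub> (pA \<rhd>\<^bsub>C\<^esub> Pr1 S \<lhd>\<^bsub>C\<^esub> iA) \<and>
       pB \<rhd>\<^bsub>C\<^esub> \<theta>P \<lhd>\<^bsub>C\<^esub> iB = ((pB \<bullet>\<^bsub>C\<^esub> iB) \<rhd>\<^bsub>C\<^esub> \<theta>B) \<odot>\<^bsub>C\<^esub> (pB \<rhd>\<^bsub>C\<^esub> Pr2 S \<lhd>\<^bsub>C\<^esub> iB))"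

end

theory Submission
  imports Defs
begin

text \<open>Horizontal composition distributes over sums and zeros, so whiskering is an additive functor
  between Hom-categories and preserves biproducts. A weak 2-product says that
  \<open>b \<mapsto> (p\<^sub>A b, p\<^sub>B b)\<close> is essentially surjective and fully faithful on every Hom-category.
  Given this, essential surjectivity yields \<open>i\<^sub>A, i\<^sub>B\<close> over \<open>(id, 0)\<close> and \<open>(0, id)\<close>, and
  \<open>\<theta>\<^sub>P\<close> is the 2-morphism with \<open>p\<^sub>A \<theta>\<^sub>P = \<theta>\<^sub>A p\<^sub>A \<odot> p\<^sub>A \<pi>\<^sub>1\<close> and
  \<open>p\<^sub>B \<theta>\<^sub>P = \<theta>\<^sub>B p\<^sub>B \<odot> p\<^sub>B \<pi>\<^sub>2\<close>. Conversely, the conditions on a weak 2-biproduct force these two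
  equations, and then \<open>i\<^sub>A f \<oplus> i\<^sub>B g\<close> represents the cone \<open>(f, g)\<close>, while the 2-morphism induced by
  \<open>\<alpha>, \<beta>\<close> is \<open>i\<^sub>A \<alpha> \<oplus> i\<^sub>B \<beta>\<close> conjugated by \<open>\<theta>\<^sub>P\<close>. The notion of weak 2-biproduct is invariant under
  reversing 1-morphisms, because \<open>e \<theta> = \<theta> e\<close> for every 2-isomorphism \<open>\<theta> : e \<Rightarrow> id\<close>; this gives the
  statement for weak 2-coproducts.\<close>

section \<open>Semiadditive categories\<close>

lemma HomD:
  assumes "f \<in> Hom K a b"
  shows "f \<in> Ar K" "Dom K f = a" "Cod K f = b"
  using assms by (auto simp: Hom_def)

text \<open>Exchanging the two summands makes every argument about the first projection available
  for the second, so the \<open>B\<close>-half of later proofs is an instance of the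
  \<open>A\<close>-half.\<close>

definition swap_biprod :: "('o, 'm) biprod_data \<Rightarrow> ('o, 'm) biprod_data" where
  "swap_biprod S = \<lparr>Sum = Sum S, Pr1 = Pr2 S, Pr2 = Pr1 S, In1 = In2 S, In2 = In1 S\<rparr>"

section \<open>Inverses, zero objects and products in a plain category\<close>

context category
begin

lemma Hom_objects:
  assumes "f \<in> Hom K a b"
  shows "a \<in> Ob K" "b \<in> Ob K"
  using assms Dom_in Cod_in by (auto simp: Hom_def)

lemma inverses_unique:
  assumes "inverses K f g" "inverses K f h"
  shows "g = h"
proof -
  let ?a = "Dom K f" and ?b = "Cod K f"
  have f: "f \<in> Hom K ?a ?b" and g: "g \<in> Hom K ?b ?a" and h: "h \<in> Hom K ?b ?a"
    using assms by (auto simp: inverses_def Hom_def)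
  have "g = (h \<cdot> f) \<cdot> g" using assms(2) Id_left[OF g] by (simp add: inverses_def)
  also have "\<dots> = h \<cdot> (f \<cdot> g)" by (rule Comp_assoc[OF g f h])
  also have "\<dots> = h" using assms(1) Id_right[OF h] by (simp add: inverses_def)
  finally show ?thesis .
qed

lemma inverse_of_eqI: "inverses K f g \<Longrightarrow> inverse_of K f = g"
  unfolding inverse_of_def by (rule the_equality) (auto dest: inverses_unique)

lemma IsosI:
  assumes "f \<in> Hom K a b" "g \<in> Hom K b a" "g \<cdot> f = Id K a" "f \<cdot> g = Id K b"
  shows "f \<in> Isos K a b"
  using assms by (auto simp: Isos_def inverses_def Hom_def)

lemma IsosE:
  assumes "f \<in> Isos K a b"
  obtains g where "f \<in> Hom K a b" "g \<in> Hom K b a" "g \<cdot> f = Id K a" "f \<cdot> g = Id K b"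
  using assms by (auto simp: Isos_def inverses_def Hom_def)

lemma inverse_of_Isos:
  assumes "f \<in> Isos K a b"
  shows "inverse_of K f \<in> Hom K b a" "inverse_of K f \<cdot> f = Id K a" "f \<cdot> inverse_of K f = Id K b"
proof -
  from assms obtain g where g: "inverses K f g" and f: "f \<in> Hom K a b"
    by (auto simp: Isos_def)
  then show "inverse_of K f \<in> Hom K b a" "inverse_of K f \<cdot> f = Id K a" "f \<cdot> inverse_of K f = Id K b"
    using inverse_of_eqI[OF g] by (auto simp: inverses_def Hom_def)
qed

lemma Id_Isos: "a \<in> Ob K \<Longrightarrow> Id K a \<in> Isos K a a"
  by (rule IsosI[OF Id_in Id_in]) (auto simp: Id_left[OF Id_in])

lemma inverse_of_Id: "a \<in> Ob K \<Longrightarrow> inverse_of K (Id K a) = Id K a"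
  using Id_in[of a] Id_left[OF Id_in, of a] by (intro inverse_of_eqI) (auto simp: inverses_def Hom_def)

lemma Comp_Isos:
  assumes "f \<in> Isos K a b" "g \<in> Isos K b c"
  shows "g \<cdot> f \<in> Isos K a c"
proof -
  obtain f' where f: "f \<in> Hom K a b" "f' \<in> Hom K b a" "f' \<cdot> f = Id K a" "f \<cdot> f' = Id K b"
    using assms(1) by (rule IsosE)
  obtain g' where g: "g \<in> Hom K b c" "g' \<in> Hom K c b" "g' \<cdot> g = Id K b" "g \<cdot> g' = Id K c"
    using assms(2) by (rule IsosE)
  have "(f' \<cdot> g') \<cdot> (g \<cdot> f) = f' \<cdot> ((g' \<cdot> g) \<cdot> f)"
    using Comp_assoc[OF Comp_in[OF f(1) g(1)] g(2) f(2)] Comp_assoc[OF f(1) g(1,2)] by simp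
  moreover have "(g \<cdot> f) \<cdot> (f' \<cdot> g') = g \<cdot> ((f \<cdot> f') \<cdot> g')"
    using Comp_assoc[OF Comp_in[OF g(2) f(2)] f(1) g(1)] Comp_assoc[OF g(2) f(2,1)] by simp
  ultimately show ?thesis
    using f g by (intro IsosI[where g = "f' \<cdot> g'"]) (auto simp: Comp_in Id_left)
qed

lemma iso_cancel_right:
  assumes "e \<in> Isos K a b" "f \<in> Hom K b c" "g \<in> Hom K b c" "f \<cdot> e = g \<cdot> e"
  shows "f = g"
proof -
  obtain d where d: "e \<in> Hom K a b" "d \<in> Hom K b a" "e \<cdot> d = Id K b"
    using assms(1) by (rule IsosE)
  have "f = (f \<cdot> e) \<cdot> d"
    using Comp_assoc[OF d(2,1) assms(2)] d(3) Id_right[OF assms(2)] by simp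
  also have "\<dots> = g"
    using Comp_assoc[OF d(2,1) assms(3)] d(3) Id_right[OF assms(3)] assms(4) by simp
  finally show ?thesis .
qed

lemma is_zero_ob_ex:
  assumes "is_zero_ob K z" "a \<in> Ob K"
  shows "\<exists>f. f \<in> Hom K a z" "\<exists>f. f \<in> Hom K z a"
  using assms unfolding is_zero_ob_def by auto

lemma is_zero_ob_unique:
  assumes "is_zero_ob K z" "f \<in> Hom K z a" "g \<in> Hom K z a"
  shows "f = g"
  using assms Hom_objects unfolding is_zero_ob_def by blast

lemma is_zero_ob_unique':
  assumes "is_zero_ob K z" "f \<in> Hom K a z" "g \<in> Hom K a z"
  shows "f = g"
  using assms Hom_objects unfolding is_zero_ob_def by blast

text \<open>Arrows into or out of \<open>y\<close> correspond to arrows into or out of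
  \<open>z\<close> by composing with the isomorphism. Later this turns
  \<open>pA \<bullet> iB\<close> and \<open>pB \<bullet> iA\<close>, which are only isomorphic to
  the chosen zero 1-morphisms, into zero objects in their own right.\<close>

lemma is_zero_ob_iso:
  assumes "is_zero_ob K z" "e \<in> Isos K y z"
  shows "is_zero_ob K y"
proof -
  obtain d where d: "e \<in> Hom K y z" "d \<in> Hom K z y" "d \<cdot> e = Id K y" "e \<cdot> d = Id K z"
    using assms(2) by (rule IsosE)
  have "\<exists>!f. f \<in> Hom K a y" if a: "a \<in> Ob K" for a
  proof -
    obtain f where f: "f \<in> Hom K a z" using is_zero_ob_ex(1)[OF assms(1) a] ..
    have "g = d \<cdot> f" if g: "g \<in> Hom K a y" for g
    proof -
      have "e \<cdot> g = f" using is_zero_ob_unique'[OF assms(1)] Comp_in[OF g d(1)] f by blast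
      then show ?thesis using Comp_assoc[OF g d(1,2)] d(3) Id_left[OF g] by simp
    qed
    with Comp_in[OF f d(2)] show ?thesis by blast
  qed
  moreover have "\<exists>!f. f \<in> Hom K y a" if a: "a \<in> Ob K" for a
  proof -
    obtain f where f: "f \<in> Hom K z a" using is_zero_ob_ex(2)[OF assms(1) a] ..
    have "g = f \<cdot> e" if g: "g \<in> Hom K y a" for g
    proof -
      have "g \<cdot> d = f" using is_zero_ob_unique[OF assms(1)] Comp_in[OF d(2) g] f by blast
      then show ?thesis using Comp_assoc[OF d(1,2) g] d(3) Id_right[OF g] by simp
    qed
    with Comp_in[OF d(1) f] show ?thesis by blast
  qed
  ultimately show ?thesis using Hom_objects[OF d(1)] by (simp add: is_zero_ob_def)
qed

text \<open>Unique existence is split into existence of a pairing and joint monicity of the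
  projections; the conditions that \<open>x\<close> be an object are absorbed into the typing of the
  arrows.\<close>

lemma is_productD:
  assumes "is_product K a b s p q"
  shows "s \<in> Ob K" "p \<in> Hom K s a" "q \<in> Hom K s b"
    "\<And>f g x. \<lbrakk>f \<in> Hom K x a; g \<in> Hom K x b\<rbrakk> \<Longrightarrow> \<exists>h. h \<in> Hom K x s \<and> p \<cdot> h = f \<and> q \<cdot> h = g"
    "\<And>h k x. \<lbrakk>h \<in> Hom K x s; k \<in> Hom K x s; p \<cdot> h = p \<cdot> k; q \<cdot> h = q \<cdot> k\<rbrakk> \<Longrightarrow> h = k"
proof -
  show s: "s \<in> Ob K" and p: "p \<in> Hom K s a" and q: "q \<in> Hom K s b"
    using assms by (auto simp: is_product_def)
  have u: "\<exists>!h. h \<in> Hom K x s \<and> p \<cdot> h = f \<and> q \<cdot> h = g"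
    if "f \<in> Hom K x a" "g \<in> Hom K x b" for f g x
    using assms that Hom_objects unfolding is_product_def by blast
  show "\<exists>h. h \<in> Hom K x s \<and> p \<cdot> h = f \<and> q \<cdot> h = g"
    if "f \<in> Hom K x a" "g \<in> Hom K x b" for f g x
    using u[OF that] by blast
  show "h = k" if "h \<in> Hom K x s" "k \<in> Hom K x s" "p \<cdot> h = p \<cdot> k" "q \<cdot> h = q \<cdot> k" for h k x
    using u[OF Comp_in[OF that(1) p] Comp_in[OF that(1) q]] that by auto
qed

lemma is_coproductD:
  assumes "is_coproduct K a b s i j"
  shows "s \<in> Ob K" "i \<in> Hom K a s" "j \<in> Hom K b s"
    "\<And>f g x. \<lbrakk>f \<in> Hom K a x; g \<in> Hom K b x\<rbrakk> \<Longrightarrow> \<exists>h. h \<in> Hom K s x \<and> h \<cdot> i = f \<and> h \<cdot> j = g"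
    "\<And>h k x. \<lbrakk>h \<in> Hom K s x; k \<in> Hom K s x; h \<cdot> i = k \<cdot> i; h \<cdot> j = k \<cdot> j\<rbrakk> \<Longrightarrow> h = k"
proof -
  show s: "s \<in> Ob K" and p: "i \<in> Hom K a s" and q: "j \<in> Hom K b s"
    using assms by (auto simp: is_coproduct_def)
  have u: "\<exists>!h. h \<in> Hom K s x \<and> h \<cdot> i = f \<and> h \<cdot> j = g"
    if "f \<in> Hom K a x" "g \<in> Hom K b x" for f g x
    using assms that Hom_objects unfolding is_coproduct_def by blast
  show "\<exists>h. h \<in> Hom K s x \<and> h \<cdot> i = f \<and> h \<cdot> j = g"
    if "f \<in> Hom K a x" "g \<in> Hom K b x" for f g x
    using u[OF that] by blast
  show "h = k" if "h \<in> Hom K s x" "k \<in> Hom K s x" "h \<cdot> i = k \<cdot> i" "h \<cdot> j = k \<cdot> j" for h k x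
    using u[OF Comp_in[OF p that(1)] Comp_in[OF q that(1)]] that by auto
qed

text \<open>The pairing \<open>n\<close> of the identity of \<open>a\<close> with the arrow from
  \<open>a\<close> to \<open>b\<close> splits \<open>p\<close>. The composite
  \<open>n \<cdot> p\<close> agrees with the identity after \<open>p\<close> by construction, and
  after \<open>q\<close> because arrows into a zero object are unique.\<close>

lemma is_product_zero_Isos:
  assumes prod: "is_product K a b s p q" and z: "is_zero_ob K b"
  shows "p \<in> Isos K s a"
proof -
  note P = is_productD[OF prod]
  have a: "a \<in> Ob K" using Hom_objects[OF P(2)] by blast
  obtain t where t: "t \<in> Hom K a b" using is_zero_ob_ex(1)[OF z a] ..
  obtain n where n: "n \<in> Hom K a s" "p \<cdot> n = Id K a"
    using P(4)[OF Id_in[OF a] t] by blast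
  have "n \<cdot> p = Id K s"
  proof (rule P(5))
    show np: "n \<cdot> p \<in> Hom K s s" "Id K s \<in> Hom K s s" by (rule Comp_in[OF P(2) n(1)], rule Id_in[OF P(1)])
    show "p \<cdot> n \<cdot> p = p \<cdot> Id K s"
      using Comp_assoc[OF P(2) n(1) P(2)] n(2) Id_left[OF P(2)] Id_right[OF P(2)] by simp
    show "q \<cdot> n \<cdot> p = q \<cdot> Id K s"
      using is_zero_ob_unique'[OF z Comp_in[OF np(1) P(3)] Comp_in[OF np(2) P(3)]] .
  qed
  then show ?thesis using IsosI[OF P(2) n(1)] n(2) by blast
qed

lemma is_product_swap: "is_product K a b s p q \<Longrightarrow> is_product K b a s q p"
  unfolding is_product_def by (simp add: conj_commute)

lemma is_coproduct_swap: "is_coproduct K a b s p q \<Longrightarrow> is_coproduct K b a s q p"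
  unfolding is_coproduct_def by (simp add: conj_commute)

lemma is_biproduct_swap: "is_biproduct K a b S \<Longrightarrow> is_biproduct K b a (swap_biprod S)"
  by (auto simp: is_biproduct_def swap_biprod_def is_product_swap is_coproduct_swap)

end

section \<open>Zero morphisms and the induced addition in a semiadditive category\<close>

locale semiadditive_category = category +
  assumes semiadditive: "semiadditive K"
begin

lemma zero_ob: "is_zero_ob K (zero_ob K)"
  using semiadditive unfolding semiadditive_def zero_ob_def by (metis someI_ex)

lemma biprod: "a \<in> Ob K \<Longrightarrow> b \<in> Ob K \<Longrightarrow> is_biproduct K a b (biprod K a b)"
  using semiadditive unfolding semiadditive_def biprod_def by (metis someI_ex)

text \<open>The definite descriptions in \<open>zero_mor\<close> are resolved here once; afterwards
  any factorisation through the zero object computes the zero morphism.\<close>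

lemma zero_mor_eq:
  assumes "f \<in> Hom K a (zero_ob K)" "g \<in> Hom K (zero_ob K) b"
  shows "zero_mor K a b = g \<cdot> f"
proof -
  have "(THE g. g \<in> Hom K (zero_ob K) b) = g"
    using is_zero_ob_unique[OF zero_ob _ assms(2)] assms(2) by blast
  moreover have "(THE f. f \<in> Hom K a (zero_ob K)) = f"
    using is_zero_ob_unique'[OF zero_ob _ assms(1)] assms(1) by blast
  ultimately show ?thesis by (simp add: zero_mor_def)
qed

lemma zero_morE:
  assumes "a \<in> Ob K" "b \<in> Ob K"
  obtains f g where "f \<in> Hom K a (zero_ob K)" "g \<in> Hom K (zero_ob K) b" "zero_mor K a b = g \<cdot> f"
proof -
  obtain f g where "f \<in> Hom K a (zero_ob K)" "g \<in> Hom K (zero_ob K) b"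
    using is_zero_ob_ex[OF zero_ob] assms by blast
  then show ?thesis using that zero_mor_eq by simp
qed

lemma zero_mor_in: "a \<in> Ob K \<Longrightarrow> b \<in> Ob K \<Longrightarrow> zero_mor K a b \<in> Hom K a b"
  by (erule zero_morE, assumption) (simp add: Comp_in)

lemma Comp_zero_right:
  assumes "a \<in> Ob K" "h \<in> Hom K b c"
  shows "h \<cdot> zero_mor K a b = zero_mor K a c"
proof -
  obtain f g where fg: "f \<in> Hom K a (zero_ob K)" "g \<in> Hom K (zero_ob K) b" "zero_mor K a b = g \<cdot> f"
    by (rule zero_morE[OF assms(1) Hom_objects(1)[OF assms(2)]])
  then show ?thesis
    using Comp_assoc[OF fg(1,2) assms(2)] zero_mor_eq[OF fg(1) Comp_in[OF fg(2) assms(2)]] by simp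
qed

lemma Comp_zero_left:
  assumes "c \<in> Ob K" "h \<in> Hom K a b"
  shows "zero_mor K b c \<cdot> h = zero_mor K a c"
proof -
  obtain f g where fg: "f \<in> Hom K b (zero_ob K)" "g \<in> Hom K (zero_ob K) c" "zero_mor K b c = g \<cdot> f"
    by (rule zero_morE[OF Hom_objects(2)[OF assms(2)] assms(1)])
  then show ?thesis
    using Comp_assoc[OF assms(2) fg(1,2)] zero_mor_eq[OF Comp_in[OF assms(2) fg(1)] fg(2)] by simp
qed

text \<open>If the identity of \<open>z\<close> is zero, then composing an arrow with it shows that
  every arrow into or out of \<open>z\<close> is zero. Together with \<open>is_zero_obD\<close> this
  makes being a zero object an equation, hence a property preserved by functors that respect
  identities and zero morphisms.\<close>

lemma is_zero_obI:
  assumes "z \<in> Ob K" "Id K z = zero_mor K z z"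
  shows "is_zero_ob K z"
proof -
  have "\<exists>!f. f \<in> Hom K a z" if a: "a \<in> Ob K" for a
  proof
    show "zero_mor K a z \<in> Hom K a z" by (rule zero_mor_in[OF a assms(1)])
    show "f = zero_mor K a z" if "f \<in> Hom K a z" for f
      using Comp_zero_left[OF assms(1) that] Id_left[OF that] assms(2) by simp
  qed
  moreover have "\<exists>!f. f \<in> Hom K z a" if a: "a \<in> Ob K" for a
  proof
    show "zero_mor K z a \<in> Hom K z a" by (rule zero_mor_in[OF assms(1) a])
    show "f = zero_mor K z a" if "f \<in> Hom K z a" for f
      using Comp_zero_right[OF assms(1) that] Id_right[OF that] assms(2) by simp
  qed
  ultimately show ?thesis using assms(1) by (simp add: is_zero_ob_def)
qed

lemma is_zero_obD:
  assumes "is_zero_ob K z"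
  shows "Id K z = zero_mor K z z"
proof -
  have z: "z \<in> Ob K" using assms by (simp add: is_zero_ob_def)
  show ?thesis using is_zero_ob_unique[OF assms Id_in[OF z] zero_mor_in[OF z z]] .
qed

lemma biproductD:
  assumes "is_biproduct K a b S"
  shows "is_product K a b (Sum S) (Pr1 S) (Pr2 S)" "is_coproduct K a b (Sum S) (In1 S) (In2 S)"
    "Pr1 S \<cdot> In1 S = Id K a" "Pr2 S \<cdot> In2 S = Id K b"
    "Pr2 S \<cdot> In1 S = zero_mor K a b" "Pr1 S \<cdot> In2 S = zero_mor K b a"
  using assms by (auto simp: is_biproduct_def)

text \<open>Joint monicity of the projections and joint epicity of the injections resolve the two
  descriptions in \<open>add_mor\<close>: any diagonal \<open>d\<close> and any copairing
  \<open>c\<close> with the right components compute the sum.\<close>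

lemma add_mor_eq:
  assumes S: "S = biprod K a a"
    and d: "d \<in> Hom K a (Sum S)" "Pr1 S \<cdot> d = Id K a" "Pr2 S \<cdot> d = Id K a"
    and c: "c \<in> Hom K (Sum S) b" "c \<cdot> In1 S = f" "c \<cdot> In2 S = g"
  shows "add_mor K f g = c \<cdot> d"
proof -
  have a: "a \<in> Ob K" using Hom_objects[OF d(1)] by blast
  note B = biproductD[OF biprod[OF a a, folded S]]
  note P = is_productD[OF B(1)] and Q = is_coproductD[OF B(2)]
  have f: "f \<in> Hom K a b" using Comp_in[OF Q(2) c(1)] c(2) by simp
  have "(THE d. d \<in> Hom K a (Sum S) \<and> Pr1 S \<cdot> d = Id K a \<and> Pr2 S \<cdot> d = Id K a) = d"
    by (rule the_equality) (use d P(5) in auto)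
  moreover have "(THE c. c \<in> Hom K (Sum S) b \<and> c \<cdot> In1 S = f \<and> c \<cdot> In2 S = g) = c"
    by (rule the_equality) (use c Q(5) in auto)
  ultimately show ?thesis
    using HomD[OF f] S by (simp add: add_mor_def)
qed

lemma add_morE:
  assumes "f \<in> Hom K a b" "g \<in> Hom K a b"
  obtains S d c where "S = biprod K a a" "is_biproduct K a a S" "d \<in> Hom K a (Sum S)"
    "Pr1 S \<cdot> d = Id K a" "Pr2 S \<cdot> d = Id K a"
    "c \<in> Hom K (Sum S) b" "c \<cdot> In1 S = f" "c \<cdot> In2 S = g" "add_mor K f g = c \<cdot> d"
proof -
  define S where "S = biprod K a a"
  have a: "a \<in> Ob K" using Hom_objects[OF assms(1)] by blast
  note S' = biprod[OF a a, folded S_def]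
  note B = biproductD[OF S']
  obtain d where d: "d \<in> Hom K a (Sum S)" "Pr1 S \<cdot> d = Id K a" "Pr2 S \<cdot> d = Id K a"
    using is_productD(4)[OF B(1) Id_in[OF a] Id_in[OF a]] by blast
  obtain c where c: "c \<in> Hom K (Sum S) b" "c \<cdot> In1 S = f" "c \<cdot> In2 S = g"
    using is_coproductD(4)[OF B(2) assms] by blast
  show ?thesis using that[OF S_def S' d c add_mor_eq[OF S_def d c]] .
qed

lemma add_mor_in: "f \<in> Hom K a b \<Longrightarrow> g \<in> Hom K a b \<Longrightarrow> add_mor K f g \<in> Hom K a b"
  by (erule add_morE, assumption) (simp add: Comp_in)

text \<open>Postcomposing the copairing of \<open>f\<close> and \<open>g\<close> with
  \<open>h\<close> gives the copairing of \<open>h \<cdot> f\<close> and \<open>h \<cdot> g\<close>,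
  while the diagonal stays the same.\<close>

lemma add_mor_left_distrib:
  assumes "f \<in> Hom K a b" "g \<in> Hom K a b" "h \<in> Hom K b c"
  shows "h \<cdot> add_mor K f g = add_mor K (h \<cdot> f) (h \<cdot> g)"
proof -
  obtain S d k where S: "S = biprod K a a" "is_biproduct K a a S" and d: "d \<in> Hom K a (Sum S)"
    "Pr1 S \<cdot> d = Id K a" "Pr2 S \<cdot> d = Id K a" and
    k: "k \<in> Hom K (Sum S) b" "k \<cdot> In1 S = f" "k \<cdot> In2 S = g" and fg: "add_mor K f g = k \<cdot> d"
    using add_morE[OF assms(1,2)] .
  note Q = is_coproductD[OF biproductD(2)[OF S(2)]]
  have "add_mor K (h \<cdot> f) (h \<cdot> g) = (h \<cdot> k) \<cdot> d"
    using Comp_assoc[OF Q(2) k(1) assms(3)] Comp_assoc[OF Q(3) k(1) assms(3)] k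
    by (intro add_mor_eq[OF S(1) d Comp_in[OF k(1) assms(3)]]) auto
  then show ?thesis using fg Comp_assoc[OF d(1) k(1) assms(3)] by simp
qed

text \<open>Here the domain changes, so the diagonals of \<open>a\<close> and \<open>b\<close> have
  to be compared. The comparison is the arrow of biproducts induced by \<open>h\<close> on both
  summands, which is natural for both the diagonal and the injections.\<close>

lemma add_mor_right_distrib:
  assumes "f \<in> Hom K b c" "g \<in> Hom K b c" "h \<in> Hom K a b"
  shows "add_mor K f g \<cdot> h = add_mor K (f \<cdot> h) (g \<cdot> h)"
proof -
  obtain T e k where T: "T = biprod K b b" "is_biproduct K b b T" and e: "e \<in> Hom K b (Sum T)"
    "Pr1 T \<cdot> e = Id K b" "Pr2 T \<cdot> e = Id K b" and
    k: "k \<in> Hom K (Sum T) c" "k \<cdot> In1 T = f" "k \<cdot> In2 T = g" and fg: "add_mor K f g = k \<cdot> e"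
    using add_morE[OF assms(1,2)] .
  have a: "a \<in> Ob K" and b: "b \<in> Ob K" using Hom_objects[OF assms(3)] by auto
  define S where "S = biprod K a a"
  note B = biproductD[OF biprod[OF a a, folded S_def]] and B' = biproductD[OF T(2)]
  note P = is_productD[OF B(1)] and Q = is_coproductD[OF B(2)]
  note P' = is_productD[OF B'(1)] and Q' = is_coproductD[OF B'(2)]
  obtain d where d: "d \<in> Hom K a (Sum S)" "Pr1 S \<cdot> d = Id K a" "Pr2 S \<cdot> d = Id K a"
    using P(4)[OF Id_in[OF a] Id_in[OF a]] by blast
  \<comment> \<open>\<open>m\<close> is the direct sum of \<open>h\<close> with itself, defined
    through the product structure of \<open>T\<close>.\<close>
  obtain m where m: "m \<in> Hom K (Sum S) (Sum T)" "Pr1 T \<cdot> m = h \<cdot> Pr1 S" "Pr2 T \<cdot> m = h \<cdot> Pr2 S"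
    using P'(4)[OF Comp_in[OF P(2) assms(3)] Comp_in[OF P(3) assms(3)]] by blast
  \<comment> \<open>Compatibility with the injections is not part of the definition of
    \<open>m\<close>. It is tested after the projections of \<open>T\<close>: diagonal entries give
    \<open>h\<close>, off-diagonal entries vanish since zero morphisms absorb \<open>h\<close> on
    either side.\<close>
  have i1: "m \<cdot> In1 S = In1 T \<cdot> h"
  proof (rule P'(5))
    show "m \<cdot> In1 S \<in> Hom K a (Sum T)" "In1 T \<cdot> h \<in> Hom K a (Sum T)"
      by (rule Comp_in[OF Q(2) m(1)], rule Comp_in[OF assms(3) Q'(2)])
    have "Pr1 T \<cdot> m \<cdot> In1 S = h \<cdot> Pr1 S \<cdot> In1 S"
      using Comp_assoc[OF Q(2) m(1) P'(2)] Comp_assoc[OF Q(2) P(2) assms(3)] m(2) by simp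
    also have "\<dots> = Pr1 T \<cdot> In1 T \<cdot> h"
      using Comp_assoc[OF assms(3) Q'(2) P'(2)] B(3) B'(3) Id_left[OF assms(3)] Id_right[OF assms(3)]
      by simp
    finally show "Pr1 T \<cdot> m \<cdot> In1 S = Pr1 T \<cdot> In1 T \<cdot> h" .
    have "Pr2 T \<cdot> m \<cdot> In1 S = h \<cdot> Pr2 S \<cdot> In1 S"
      using Comp_assoc[OF Q(2) m(1) P'(3)] Comp_assoc[OF Q(2) P(3) assms(3)] m(3) by simp
    also have "\<dots> = Pr2 T \<cdot> In1 T \<cdot> h"
      using Comp_assoc[OF assms(3) Q'(2) P'(3)] B(5) B'(5)
        Comp_zero_left[OF b assms(3)] Comp_zero_right[OF a assms(3)] by simp
    finally show "Pr2 T \<cdot> m \<cdot> In1 S = Pr2 T \<cdot> In1 T \<cdot> h" .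
  qed
  have i2: "m \<cdot> In2 S = In2 T \<cdot> h"
  proof (rule P'(5))
    show "m \<cdot> In2 S \<in> Hom K a (Sum T)" "In2 T \<cdot> h \<in> Hom K a (Sum T)"
      by (rule Comp_in[OF Q(3) m(1)], rule Comp_in[OF assms(3) Q'(3)])
    have "Pr2 T \<cdot> m \<cdot> In2 S = h \<cdot> Pr2 S \<cdot> In2 S"
      using Comp_assoc[OF Q(3) m(1) P'(3)] Comp_assoc[OF Q(3) P(3) assms(3)] m(3) by simp
    also have "\<dots> = Pr2 T \<cdot> In2 T \<cdot> h"
      using Comp_assoc[OF assms(3) Q'(3) P'(3)] B(4) B'(4) Id_left[OF assms(3)] Id_right[OF assms(3)]
      by simp
    finally show "Pr2 T \<cdot> m \<cdot> In2 S = Pr2 T \<cdot> In2 T \<cdot> h" .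
    have "Pr1 T \<cdot> m \<cdot> In2 S = h \<cdot> Pr1 S \<cdot> In2 S"
      using Comp_assoc[OF Q(3) m(1) P'(2)] Comp_assoc[OF Q(3) P(2) assms(3)] m(2) by simp
    also have "\<dots> = Pr1 T \<cdot> In2 T \<cdot> h"
      using Comp_assoc[OF assms(3) Q'(3) P'(2)] B(6) B'(6)
        Comp_zero_left[OF b assms(3)] Comp_zero_right[OF a assms(3)] by simp
    finally show "Pr1 T \<cdot> m \<cdot> In2 S = Pr1 T \<cdot> In2 T \<cdot> h" .
  qed
  \<comment> \<open>Naturality of the diagonal: both sides have \<open>h\<close> as both
    components.\<close>
  have md: "m \<cdot> d = e \<cdot> h"
  proof (rule P'(5))
    show "m \<cdot> d \<in> Hom K a (Sum T)" "e \<cdot> h \<in> Hom K a (Sum T)"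
      by (rule Comp_in[OF d(1) m(1)], rule Comp_in[OF assms(3) e(1)])
    show "Pr1 T \<cdot> m \<cdot> d = Pr1 T \<cdot> e \<cdot> h"
      using Comp_assoc[OF d(1) m(1) P'(2)] Comp_assoc[OF d(1) P(2) assms(3)]
        Comp_assoc[OF assms(3) e(1) P'(2)] m(2) d(2) e(2) Id_left[OF assms(3)] Id_right[OF assms(3)]
      by simp
    show "Pr2 T \<cdot> m \<cdot> d = Pr2 T \<cdot> e \<cdot> h"
      using Comp_assoc[OF d(1) m(1) P'(3)] Comp_assoc[OF d(1) P(3) assms(3)]
        Comp_assoc[OF assms(3) e(1) P'(3)] m(3) d(3) e(3) Id_left[OF assms(3)] Id_right[OF assms(3)]
      by simp
  qed
  have "add_mor K (f \<cdot> h) (g \<cdot> h) = (k \<cdot> m) \<cdot> d"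
  proof (rule add_mor_eq[OF S_def d Comp_in[OF m(1) k(1)]])
    show "(k \<cdot> m) \<cdot> In1 S = f \<cdot> h"
      using Comp_assoc[OF Q(2) m(1) k(1)] Comp_assoc[OF assms(3) Q'(2) k(1)] i1 k(2) by simp
    show "(k \<cdot> m) \<cdot> In2 S = g \<cdot> h"
      using Comp_assoc[OF Q(3) m(1) k(1)] Comp_assoc[OF assms(3) Q'(3) k(1)] i2 k(3) by simp
  qed
  also have "\<dots> = add_mor K f g \<cdot> h"
    using Comp_assoc[OF d(1) m(1) k(1)] Comp_assoc[OF assms(3) e(1) k(1)] md fg by simp
  finally show ?thesis by simp
qed

text \<open>The copairing of \<open>f\<close> and the zero morphism is
  \<open>f \<cdot> Pr1 S\<close>, and \<open>Pr1 S\<close> composed with the diagonal is the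
  identity.\<close>

lemma add_mor_zero_right:
  assumes "f \<in> Hom K a b"
  shows "add_mor K f (zero_mor K a b) = f"
proof -
  have a: "a \<in> Ob K" and b: "b \<in> Ob K" using Hom_objects[OF assms] by auto
  obtain S d c where S: "S = biprod K a a" "is_biproduct K a a S" and d: "d \<in> Hom K a (Sum S)"
    "Pr1 S \<cdot> d = Id K a" "Pr2 S \<cdot> d = Id K a"
    using add_morE[OF assms assms] .
  note B = biproductD[OF S(2)]
  note P = is_productD[OF B(1)] and Q = is_coproductD[OF B(2)]
  have "add_mor K f (zero_mor K a b) = (f \<cdot> Pr1 S) \<cdot> d"
    using Comp_assoc[OF Q(2) P(2) assms] Comp_assoc[OF Q(3) P(2) assms] B(3,6)
      Id_right[OF assms] Comp_zero_right[OF a assms]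
    by (intro add_mor_eq[OF S(1) d Comp_in[OF P(2) assms]]) auto
  then show ?thesis using Comp_assoc[OF d(1) P(2) assms] d(2) Id_right[OF assms] by simp
qed

lemma add_mor_zero_left:
  assumes "f \<in> Hom K a b"
  shows "add_mor K (zero_mor K a b) f = f"
proof -
  have a: "a \<in> Ob K" and b: "b \<in> Ob K" using Hom_objects[OF assms] by auto
  obtain S d c where S: "S = biprod K a a" "is_biproduct K a a S" and d: "d \<in> Hom K a (Sum S)"
    "Pr1 S \<cdot> d = Id K a" "Pr2 S \<cdot> d = Id K a"
    using add_morE[OF assms assms] .
  note B = biproductD[OF S(2)]
  note P = is_productD[OF B(1)] and Q = is_coproductD[OF B(2)]
  have "add_mor K (zero_mor K a b) f = (f \<cdot> Pr2 S) \<cdot> d"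
    using Comp_assoc[OF Q(2) P(3) assms] Comp_assoc[OF Q(3) P(3) assms] B(4,5)
      Id_right[OF assms] Comp_zero_right[OF a assms]
    by (intro add_mor_eq[OF S(1) d Comp_in[OF P(3) assms]]) auto
  then show ?thesis using Comp_assoc[OF d(1) P(3) assms] d(3) Id_right[OF assms] by simp
qed

text \<open>Both sides are compared after each projection, where distributivity leaves one surviving
  summand.\<close>

lemma biproduct_add_Id:
  assumes "is_biproduct K a b S"
  shows "add_mor K (In1 S \<cdot> Pr1 S) (In2 S \<cdot> Pr2 S) = Id K (Sum S)"
proof -
  note B = biproductD[OF assms]
  note P = is_productD[OF B(1)] and Q = is_coproductD[OF B(2)]
  have a: "a \<in> Ob K" and b: "b \<in> Ob K" using Hom_objects[OF Q(2)] Hom_objects[OF Q(3)] by auto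
  have e1: "In1 S \<cdot> Pr1 S \<in> Hom K (Sum S) (Sum S)" and e2: "In2 S \<cdot> Pr2 S \<in> Hom K (Sum S) (Sum S)"
    by (rule Comp_in[OF P(2) Q(2)], rule Comp_in[OF P(3) Q(3)])
  show ?thesis
  proof (rule P(5)[OF add_mor_in[OF e1 e2] Id_in[OF P(1)]])
    have "Pr1 S \<cdot> add_mor K (In1 S \<cdot> Pr1 S) (In2 S \<cdot> Pr2 S)
      = add_mor K ((Pr1 S \<cdot> In1 S) \<cdot> Pr1 S) ((Pr1 S \<cdot> In2 S) \<cdot> Pr2 S)"
      using Comp_assoc[OF P(2) Q(2) P(2)] Comp_assoc[OF P(3) Q(3) P(2)]
        add_mor_left_distrib[OF e1 e2 P(2)] by simp
    then show "Pr1 S \<cdot> add_mor K (In1 S \<cdot> Pr1 S) (In2 S \<cdot> Pr2 S) = Pr1 S \<cdot> Id K (Sum S)"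
      using B(3,6) Id_left[OF P(2)] Id_right[OF P(2)] Comp_zero_left[OF a P(3)]
        add_mor_zero_right[OF P(2)] by simp
    have "Pr2 S \<cdot> add_mor K (In1 S \<cdot> Pr1 S) (In2 S \<cdot> Pr2 S)
      = add_mor K ((Pr2 S \<cdot> In1 S) \<cdot> Pr1 S) ((Pr2 S \<cdot> In2 S) \<cdot> Pr2 S)"
      using Comp_assoc[OF P(2) Q(2) P(3)] Comp_assoc[OF P(3) Q(3) P(3)]
        add_mor_left_distrib[OF e1 e2 P(3)] by simp
    then show "Pr2 S \<cdot> add_mor K (In1 S \<cdot> Pr1 S) (In2 S \<cdot> Pr2 S) = Pr2 S \<cdot> Id K (Sum S)"
      using B(4,5) Id_left[OF P(3)] Id_right[OF P(3)] Comp_zero_left[OF b P(2)]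
        add_mor_zero_left[OF P(3)] by simp
  qed
qed

text \<open>The pairing of \<open>f\<close> and \<open>g\<close> is
  \<open>add_mor K (i \<cdot> f) (j \<cdot> g)\<close>; it is the only one because any
  \<open>h\<close> equals the decomposed identity composed with \<open>h\<close>. The hypotheses are
  equations in composition, zero and sum, so an additive functor carries them over.\<close>

lemma is_productI:
  assumes p: "p \<in> Hom K s a" and q: "q \<in> Hom K s b" and i: "i \<in> Hom K a s" and j: "j \<in> Hom K b s"
    and eqs: "p \<cdot> i = Id K a" "q \<cdot> j = Id K b" "q \<cdot> i = zero_mor K a b" "p \<cdot> j = zero_mor K b a"
    and sum: "add_mor K (i \<cdot> p) (j \<cdot> q) = Id K s"
  shows "is_product K a b s p q"
proof -
  have ob: "a \<in> Ob K" "b \<in> Ob K" "s \<in> Ob K" using Hom_objects p q by auto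
  have "\<exists>!h. h \<in> Hom K x s \<and> p \<cdot> h = f \<and> q \<cdot> h = g"
    if f: "f \<in> Hom K x a" and g: "g \<in> Hom K x b" for x f g
  proof
    let ?h = "add_mor K (i \<cdot> f) (j \<cdot> g)"
    have jf: "i \<cdot> f \<in> Hom K x s" and jg: "j \<cdot> g \<in> Hom K x s"
      by (rule Comp_in[OF f i], rule Comp_in[OF g j])
    have "p \<cdot> ?h = add_mor K ((p \<cdot> i) \<cdot> f) ((p \<cdot> j) \<cdot> g)"
      using add_mor_left_distrib[OF jf jg p] Comp_assoc[OF f i p] Comp_assoc[OF g j p] by simp
    then have 1: "p \<cdot> ?h = f"
      using eqs Id_left[OF f] Comp_zero_left[OF ob(1) g] add_mor_zero_right[OF f] by simp
    have "q \<cdot> ?h = add_mor K ((q \<cdot> i) \<cdot> f) ((q \<cdot> j) \<cdot> g)"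
      using add_mor_left_distrib[OF jf jg q] Comp_assoc[OF f i q] Comp_assoc[OF g j q] by simp
    then have 2: "q \<cdot> ?h = g"
      using eqs Id_left[OF g] Comp_zero_left[OF ob(2) f] add_mor_zero_left[OF g] by simp
    show "?h \<in> Hom K x s \<and> p \<cdot> ?h = f \<and> q \<cdot> ?h = g"
      using 1 2 add_mor_in[OF jf jg] by blast
    show "h = ?h" if h: "h \<in> Hom K x s \<and> p \<cdot> h = f \<and> q \<cdot> h = g" for h
    proof -
      have h': "h \<in> Hom K x s" using h by blast
      have "h = add_mor K (i \<cdot> p) (j \<cdot> q) \<cdot> h" using sum Id_left[OF h'] by simp
      also have "\<dots> = ?h"
        using add_mor_right_distrib[OF Comp_in[OF p i] Comp_in[OF q j] h']
          Comp_assoc[OF h' p i] Comp_assoc[OF h' q j] h by simp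
      finally show ?thesis .
    qed
  qed
  then show ?thesis using p q ob unfolding is_product_def by blast
qed

end

section \<open>Additive functors and their preservation of zero objects and biproducts\<close>

text \<open>Preservation of zero morphisms is listed apart from preservation of sums: the latter
  only makes the image of a zero morphism idempotent under addition, which need not force it to be
  zero without cancellation.\<close>

locale additive_functor = K: semiadditive_category K + L: semiadditive_category L
  for K :: "('o, 'm) cat" and L :: "('p, 'n) cat" +
  fixes Fo :: "'o \<Rightarrow> 'p" and F :: "'m \<Rightarrow> 'n"
  assumes F_in: "f \<in> Hom K a b \<Longrightarrow> F f \<in> Hom L (Fo a) (Fo b)"
    and F_Id: "a \<in> Ob K \<Longrightarrow> F (Id K a) = Id L (Fo a)"
    and F_Comp: "\<lbrakk>f \<in> Hom K a b; g \<in> Hom K b c\<rbrakk> \<Longrightarrow> F (g \<cdot>\<^bsub>K\<^esub> f) = F g \<cdot>\<^bsub>L\<^esub> F f"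
    and F_zero: "\<lbrakk>a \<in> Ob K; b \<in> Ob K\<rbrakk> \<Longrightarrow> F (zero_mor K a b) = zero_mor L (Fo a) (Fo b)"
    and F_add: "\<lbrakk>f \<in> Hom K a b; g \<in> Hom K a b\<rbrakk> \<Longrightarrow> F (add_mor K f g) = add_mor L (F f) (F g)"
begin

lemma F_zero_ob:
  assumes "is_zero_ob K z"
  shows "is_zero_ob L (Fo z)"
proof -
  have z: "z \<in> Ob K" using assms by (simp add: is_zero_ob_def)
  show ?thesis
    using L.Hom_objects[OF F_in[OF K.Id_in[OF z]]] F_zero[OF z z] F_Id[OF z] K.is_zero_obD[OF assms]
    by (intro L.is_zero_obI) auto
qed

lemma F_product:
  assumes "is_biproduct K a b S"
  shows "is_product L (Fo a) (Fo b) (Fo (Sum S)) (F (Pr1 S)) (F (Pr2 S))"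
proof -
  note B = K.biproductD[OF assms]
  note P = K.is_productD[OF B(1)] and Q = K.is_coproductD[OF B(2)]
  have ob: "a \<in> Ob K" "b \<in> Ob K" using K.Hom_objects P Q by blast+
  show ?thesis
  proof (rule L.is_productI[OF F_in[OF P(2)] F_in[OF P(3)] F_in[OF Q(2)] F_in[OF Q(3)]])
    show "F (Pr1 S) \<cdot>\<^bsub>L\<^esub> F (In1 S) = Id L (Fo a)"
      using F_Comp[OF Q(2) P(2)] B(3) F_Id ob by simp
    show "F (Pr2 S) \<cdot>\<^bsub>L\<^esub> F (In2 S) = Id L (Fo b)"
      using F_Comp[OF Q(3) P(3)] B(4) F_Id ob by simp
    show "F (Pr2 S) \<cdot>\<^bsub>L\<^esub> F (In1 S) = zero_mor L (Fo a) (Fo b)"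
      using F_Comp[OF Q(2) P(3)] B(5) F_zero ob by simp
    show "F (Pr1 S) \<cdot>\<^bsub>L\<^esub> F (In2 S) = zero_mor L (Fo b) (Fo a)"
      using F_Comp[OF Q(3) P(2)] B(6) F_zero ob by simp
    show "add_mor L (F (In1 S) \<cdot>\<^bsub>L\<^esub> F (Pr1 S)) (F (In2 S) \<cdot>\<^bsub>L\<^esub> F (Pr2 S)) = Id L (Fo (Sum S))"
      using F_add[OF K.Comp_in[OF P(2) Q(2)] K.Comp_in[OF P(3) Q(3)]]
        F_Comp[OF P(2) Q(2)] F_Comp[OF P(3) Q(3)] K.biproduct_add_Id[OF assms] F_Id[OF P(1)]
      by simp
  qed
qed

end

section \<open>Whiskering\<close>

lemma op_cat_simps [simp]:
  "Ob (op_cat K) = Ob K" "Ar (op_cat K) = Ar K" "Dom (op_cat K) = Cod K" "Cod (op_cat K) = Dom K"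
  "Id (op_cat K) = Id K" "Comp (op_cat K) g f = Comp K f g" "Hom (op_cat K) a b = Hom K b a"
  by (auto simp: op_cat_def Hom_def)

lemma hom_cat_simps [simp]:
  "Ob (hom_cat C X Y) = Hom1 C X Y" "Dom (hom_cat C X Y) = Dom (Vert C)"
  "Cod (hom_cat C X Y) = Cod (Vert C)" "Id (hom_cat C X Y) = Id (Vert C)"
  "Comp (hom_cat C X Y) = Comp (Vert C)"
  by (simp_all add: hom_cat_def)

lemma Hom_hom_cat: "\<alpha> \<in> Hom (hom_cat C X Y) f g \<longleftrightarrow>
    \<alpha> \<in> Hom2 C f g \<and> f \<in> Hom1 C X Y \<and> g \<in> Hom1 C X Y"
  by (auto simp: hom_cat_def Hom_def)

section \<open>Rewriting rules for strict 2-categories\<close>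

context two_category
begin

sublocale one: category "One C" by (rule category_One)
sublocale vert: category "Vert C" by (rule category_Vert)
sublocale hor: category "horiz C" by (rule category_horiz)

abbreviation "src1 \<equiv> Dom (One C)"
abbreviation "trg1 \<equiv> Cod (One C)"
abbreviation "src2 \<equiv> Dom (Vert C)"
abbreviation "trg2 \<equiv> Cod (Vert C)"

text \<open>Typing is phrased through \<open>Ar\<close>, sources and targets instead of Hom sets, so
  that the simplifier can compute the type of a composite and discharge the side conditions of the
  laws below; Hom statements are reduced to this form by \<open>Hom_def\<close>.\<close>

lemma typing1 [simp]:
  "f \<in> Ar (One C) \<Longrightarrow> src1 f \<in> Obj C" "f \<in> Ar (One C) \<Longrightarrow> trg1 f \<in> Obj C"
  "X \<in> Obj C \<Longrightarrow> Id (One C) X \<in> Ar (One C)"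
  "X \<in> Obj C \<Longrightarrow> src1 (Id (One C) X) = X" "X \<in> Obj C \<Longrightarrow> trg1 (Id (One C) X) = X"
  "\<lbrakk>f \<in> Ar (One C); g \<in> Ar (One C); src1 g = trg1 f\<rbrakk> \<Longrightarrow> g \<bullet> f \<in> Ar (One C)"
  "\<lbrakk>f \<in> Ar (One C); g \<in> Ar (One C); src1 g = trg1 f\<rbrakk> \<Longrightarrow> src1 (g \<bullet> f) = src1 f"
  "\<lbrakk>f \<in> Ar (One C); g \<in> Ar (One C); src1 g = trg1 f\<rbrakk> \<Longrightarrow> trg1 (g \<bullet> f) = trg1 g"
  using one.Dom_in one.Cod_in one.Id_in one.Comp_in by (auto simp: Hom_def)

lemma laws1 [simp]:
  "\<lbrakk>f \<in> Ar (One C); trg1 f = X\<rbrakk> \<Longrightarrow> Id (One C) X \<bullet> f = f"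
  "\<lbrakk>f \<in> Ar (One C); src1 f = X\<rbrakk> \<Longrightarrow> f \<bullet> Id (One C) X = f"
  "\<lbrakk>f \<in> Ar (One C); g \<in> Ar (One C); h \<in> Ar (One C); src1 g = trg1 f; src1 h = trg1 g\<rbrakk>
    \<Longrightarrow> (h \<bullet> g) \<bullet> f = h \<bullet> (g \<bullet> f)"
  using one.Id_left one.Id_right one.Comp_assoc by (auto simp: Hom_def)

lemma typing2 [simp]:
  "\<alpha> \<in> Ar (Vert C) \<Longrightarrow> src2 \<alpha> \<in> Ar (One C)" "\<alpha> \<in> Ar (Vert C) \<Longrightarrow> trg2 \<alpha> \<in> Ar (One C)"
  "f \<in> Ar (One C) \<Longrightarrow> Id (Vert C) f \<in> Ar (Vert C)"
  "f \<in> Ar (One C) \<Longrightarrow> src2 (Id (Vert C) f) = f" "f \<in> Ar (One C) \<Longrightarrow> trg2 (Id (Vert C) f) = f"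
  "\<lbrakk>\<alpha> \<in> Ar (Vert C); \<beta> \<in> Ar (Vert C); src2 \<beta> = trg2 \<alpha>\<rbrakk> \<Longrightarrow> \<beta> \<odot> \<alpha> \<in> Ar (Vert C)"
  "\<lbrakk>\<alpha> \<in> Ar (Vert C); \<beta> \<in> Ar (Vert C); src2 \<beta> = trg2 \<alpha>\<rbrakk> \<Longrightarrow> src2 (\<beta> \<odot> \<alpha>) = src2 \<alpha>"
  "\<lbrakk>\<alpha> \<in> Ar (Vert C); \<beta> \<in> Ar (Vert C); src2 \<beta> = trg2 \<alpha>\<rbrakk> \<Longrightarrow> trg2 (\<beta> \<odot> \<alpha>) = trg2 \<beta>"
  using vert.Dom_in vert.Cod_in vert.Id_in vert.Comp_in Ob_Vert by (auto simp: Hom_def)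

lemma laws2 [simp]:
  "\<lbrakk>\<alpha> \<in> Ar (Vert C); trg2 \<alpha> = f\<rbrakk> \<Longrightarrow> Id (Vert C) f \<odot> \<alpha> = \<alpha>"
  "\<lbrakk>\<alpha> \<in> Ar (Vert C); src2 \<alpha> = f\<rbrakk> \<Longrightarrow> \<alpha> \<odot> Id (Vert C) f = \<alpha>"
  "\<lbrakk>\<alpha> \<in> Ar (Vert C); \<beta> \<in> Ar (Vert C); \<gamma> \<in> Ar (Vert C); src2 \<beta> = trg2 \<alpha>; src2 \<gamma> = trg2 \<beta>\<rbrakk>
    \<Longrightarrow> (\<gamma> \<odot> \<beta>) \<odot> \<alpha> = \<gamma> \<odot> (\<beta> \<odot> \<alpha>)"
  using vert.Id_left vert.Id_right vert.Comp_assoc by (auto simp: Hom_def)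

lemma globular_simps [simp]:
  "\<alpha> \<in> Ar (Vert C) \<Longrightarrow> src1 (trg2 \<alpha>) = src1 (src2 \<alpha>)"
  "\<alpha> \<in> Ar (Vert C) \<Longrightarrow> trg1 (trg2 \<alpha>) = trg1 (src2 \<alpha>)"
  using globular by (auto simp: Hom_def)

lemma typing_HComp [simp]:
  assumes "\<alpha> \<in> Ar (Vert C)" "\<beta> \<in> Ar (Vert C)" "src1 (src2 \<beta>) = trg1 (src2 \<alpha>)"
  shows "\<beta> \<diamondop> \<alpha> \<in> Ar (Vert C)" "src2 (\<beta> \<diamondop> \<alpha>) = src2 \<beta> \<bullet> src2 \<alpha>"
    "trg2 (\<beta> \<diamondop> \<alpha>) = trg2 \<beta> \<bullet> trg2 \<alpha>"
proof -
  have "\<beta> \<diamondop> \<alpha> \<in> Hom2 C (src2 \<beta> \<bullet> src2 \<alpha>) (trg2 \<beta> \<bullet> trg2 \<alpha>)"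
    by (rule HComp_in) (use assms in \<open>auto simp: Hom_def\<close>)
  then show "\<beta> \<diamondop> \<alpha> \<in> Ar (Vert C)" "src2 (\<beta> \<diamondop> \<alpha>) = src2 \<beta> \<bullet> src2 \<alpha>"
    "trg2 (\<beta> \<diamondop> \<alpha>) = trg2 \<beta> \<bullet> trg2 \<alpha>" by (auto simp: Hom_def)
qed

lemma HComp_vcomp:
  assumes "\<alpha> \<in> Ar (Vert C)" "\<alpha>' \<in> Ar (Vert C)" "\<beta> \<in> Ar (Vert C)" "\<beta>' \<in> Ar (Vert C)"
    "src2 \<alpha>' = trg2 \<alpha>" "src2 \<beta>' = trg2 \<beta>" "src1 (src2 \<beta>) = trg1 (src2 \<alpha>)"
  shows "(\<beta>' \<odot> \<beta>) \<diamondop> (\<alpha>' \<odot> \<alpha>) = (\<beta>' \<diamondop> \<alpha>') \<odot> (\<beta> \<diamondop> \<alpha>)"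
  by (rule interchange) (use assms in \<open>auto simp: Hom_def\<close>)

lemma HComp_assoc:
  assumes "\<alpha> \<in> Ar (Vert C)" "\<beta> \<in> Ar (Vert C)" "\<gamma> \<in> Ar (Vert C)"
    "src1 (src2 \<beta>) = trg1 (src2 \<alpha>)" "src1 (src2 \<gamma>) = trg1 (src2 \<beta>)"
  shows "(\<gamma> \<diamondop> \<beta>) \<diamondop> \<alpha> = \<gamma> \<diamondop> (\<beta> \<diamondop> \<alpha>)"
proof -
  have "(\<gamma> \<cdot>\<^bsub>horiz C\<^esub> \<beta>) \<cdot>\<^bsub>horiz C\<^esub> \<alpha> = \<gamma> \<cdot>\<^bsub>horiz C\<^esub> (\<beta> \<cdot>\<^bsub>horiz C\<^esub> \<alpha>)"
    by (rule hor.Comp_assoc) (use assms in \<open>auto simp: Hom_def horiz_def\<close>)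
  then show ?thesis by (simp add: horiz_def)
qed

lemma HComp_Id_Id [simp]:
  "\<lbrakk>f \<in> Ar (One C); g \<in> Ar (One C); src1 g = trg1 f\<rbrakk>
    \<Longrightarrow> Id (Vert C) g \<diamondop> Id (Vert C) f = Id (Vert C) (g \<bullet> f)"
  by (rule HComp_Id) (auto simp: Hom_def)

text \<open>This rule and the next four bring whiskered expressions to a normal form: whiskering is
  distributed over vertical composites, repeated whiskerings on one side are merged, and the left
  whiskering stands outside the right one.\<close>

lemma lwhisk_vcomp [simp]:
  assumes "\<alpha> \<in> Ar (Vert C)" "\<beta> \<in> Ar (Vert C)" "src2 \<beta> = trg2 \<alpha>"
    "h \<in> Ar (One C)" "src1 h = trg1 (src2 \<alpha>)"
  shows "h \<rhd> (\<beta> \<odot> \<alpha>) = (h \<rhd> \<beta>) \<odot> (h \<rhd> \<alpha>)"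
  using HComp_vcomp[of \<alpha> \<beta> "Id (Vert C) h" "Id (Vert C) h"] assms by simp

lemma rwhisk_vcomp [simp]:
  assumes "\<alpha> \<in> Ar (Vert C)" "\<beta> \<in> Ar (Vert C)" "src2 \<beta> = trg2 \<alpha>"
    "h \<in> Ar (One C)" "trg1 h = src1 (src2 \<alpha>)"
  shows "(\<beta> \<odot> \<alpha>) \<lhd> h = (\<beta> \<lhd> h) \<odot> (\<alpha> \<lhd> h)"
  using HComp_vcomp[of "Id (Vert C) h" "Id (Vert C) h" \<alpha> \<beta>] assms by simp

lemma lwhisk_lwhisk [simp]:
  assumes "\<alpha> \<in> Ar (Vert C)" "h \<in> Ar (One C)" "k \<in> Ar (One C)"
    "src1 h = trg1 (src2 \<alpha>)" "src1 k = trg1 h"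
  shows "k \<rhd> (h \<rhd> \<alpha>) = (k \<bullet> h) \<rhd> \<alpha>"
  using HComp_assoc[of \<alpha> "Id (Vert C) h" "Id (Vert C) k"] assms by simp

lemma rwhisk_rwhisk [simp]:
  assumes "\<alpha> \<in> Ar (Vert C)" "h \<in> Ar (One C)" "k \<in> Ar (One C)"
    "trg1 h = src1 (src2 \<alpha>)" "trg1 k = src1 h"
  shows "(\<alpha> \<lhd> h) \<lhd> k = \<alpha> \<lhd> (h \<bullet> k)"
  using HComp_assoc[of "Id (Vert C) k" "Id (Vert C) h" \<alpha>] assms by simp

lemma lwhisk_rwhisk [simp]:
  assumes "\<alpha> \<in> Ar (Vert C)" "h \<in> Ar (One C)" "k \<in> Ar (One C)"
    "src1 h = trg1 (src2 \<alpha>)" "trg1 k = src1 (src2 \<alpha>)"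
  shows "(h \<rhd> \<alpha>) \<lhd> k = h \<rhd> (\<alpha> \<lhd> k)"
  using HComp_assoc[of "Id (Vert C) k" \<alpha> "Id (Vert C) h"] assms by simp

lemma whisk_Id [simp]:
  assumes "\<alpha> \<in> Ar (Vert C)"
  shows "trg1 (src2 \<alpha>) = X \<Longrightarrow> Id (One C) X \<rhd> \<alpha> = \<alpha>"
    "src1 (src2 \<alpha>) = X \<Longrightarrow> \<alpha> \<lhd> Id (One C) X = \<alpha>"
  using hor.Id_left[of \<alpha>] hor.Id_right[of \<alpha>] assms by (auto simp: Hom_def horiz_def)

text \<open>By interchange both sides equal \<open>\<beta> \<diamondop> \<alpha>\<close>. This is
  the naturality law behind all later steps that move one 2-morphism past another.\<close>

lemma whisk_exchange:
  assumes "\<alpha> \<in> Ar (Vert C)" "\<beta> \<in> Ar (Vert C)" "src1 (src2 \<beta>) = trg1 (src2 \<alpha>)"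
  shows "(trg2 \<beta> \<rhd> \<alpha>) \<odot> (\<beta> \<lhd> src2 \<alpha>) = (\<beta> \<lhd> trg2 \<alpha>) \<odot> (src2 \<beta> \<rhd> \<alpha>)"
  using HComp_vcomp[of "Id (Vert C) (src2 \<alpha>)" \<alpha> \<beta> "Id (Vert C) (trg2 \<beta>)"]
    HComp_vcomp[of \<alpha> "Id (Vert C) (trg2 \<alpha>)" "Id (Vert C) (src2 \<beta>)" \<beta>] assms by simp

lemma lwhisk_Isos:
  assumes "\<alpha> \<in> Iso2 C f g" "h \<in> Hom1 C Y Z" "f \<in> Hom1 C X Y"
  shows "h \<rhd> \<alpha> \<in> Iso2 C (h \<bullet> f) (h \<bullet> g)"
proof -
  obtain \<beta> where \<beta>: "\<alpha> \<in> Hom2 C f g" "\<beta> \<in> Hom2 C g f" "\<beta> \<odot> \<alpha> = Id (Vert C) f" "\<alpha> \<odot> \<beta> = Id (Vert C) g"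
    using assms(1) by (rule vert.IsosE)
  have g: "g \<in> Hom1 C X Y" using \<beta>(1) assms(3) by (auto simp: Hom_def)
  show ?thesis
    by (rule vert.IsosI[where g = "h \<rhd> \<beta>"])
      \<comment> \<open>\<open>lwhisk_vcomp\<close> is used from right to left, so that the
        composite of the two inverse 2-morphisms appears under a single whiskering.\<close>
      (use \<beta> assms g in \<open>auto simp: Hom_def lwhisk_vcomp[symmetric] simp del: lwhisk_vcomp\<close>)
qed

lemma rwhisk_Isos:
  assumes "\<alpha> \<in> Iso2 C f g" "h \<in> Hom1 C X Y" "f \<in> Hom1 C Y Z"
  shows "\<alpha> \<lhd> h \<in> Iso2 C (f \<bullet> h) (g \<bullet> h)"
proof -
  obtain \<beta> where \<beta>: "\<alpha> \<in> Hom2 C f g" "\<beta> \<in> Hom2 C g f" "\<beta> \<odot> \<alpha> = Id (Vert C) f" "\<alpha> \<odot> \<beta> = Id (Vert C) g"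
    using assms(1) by (rule vert.IsosE)
  have g: "g \<in> Hom1 C Y Z" using \<beta>(1) assms(3) by (auto simp: Hom_def)
  show ?thesis
    by (rule vert.IsosI[where g = "\<beta> \<lhd> h"])
      (use \<beta> assms g in \<open>auto simp: Hom_def rwhisk_vcomp[symmetric] simp del: rwhisk_vcomp\<close>)
qed

lemma Isos_hom_cat:
  "\<alpha> \<in> Isos (hom_cat C X Y) f g \<longleftrightarrow> \<alpha> \<in> Iso2 C f g \<and> f \<in> Hom1 C X Y \<and> g \<in> Hom1 C X Y"
  by (auto simp: Isos_def inverses_def Hom_hom_cat HomD)

text \<open>Exchanging \<theta> with itself equates the two sides after composing with \<theta>,
  which can be cancelled. For \<open>e = pA \<bullet> iA\<close> this mediates between the two ways
  of writing the matrix condition of a weak 2-biproduct.\<close>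

lemma lwhisk_eq_rwhisk_iso:
  assumes "\<theta> \<in> Iso2 C e (Id (One C) X)" "e \<in> Hom1 C X X"
  shows "e \<rhd> \<theta> = \<theta> \<lhd> e"
proof -
  have \<theta>: "\<theta> \<in> Hom2 C e (Id (One C) X)" using assms(1) by (auto simp: Isos_def)
  obtain \<eta> where \<eta>: "\<eta> \<in> Hom2 C (Id (One C) X) e" "\<eta> \<odot> \<theta> = Id (Vert C) e"
    using vert.IsosE[OF assms(1)] by blast
  have X: "X \<in> Obj C" using one.Hom_objects[OF assms(2)] by simp
  have "\<theta> \<odot> (\<theta> \<lhd> e) = \<theta> \<odot> (e \<rhd> \<theta>)"
    using whisk_exchange[of \<theta> \<theta>] \<theta> assms(2) X by (auto simp: Hom_def)
  then have "(\<eta> \<odot> \<theta>) \<odot> (\<theta> \<lhd> e) = (\<eta> \<odot> \<theta>) \<odot> (e \<rhd> \<theta>)"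
    using \<theta> \<eta>(1) assms(2) X by (auto simp: Hom_def)
  then show ?thesis unfolding \<eta>(2) using \<theta> assms(2) X by (auto simp: Hom_def)
qed

lemma category_hom_cat: "category (hom_cat C X Y)"
  by unfold_locales (auto simp: Hom_hom_cat, auto simp: hom_cat_def Hom_def)

end

section \<open>Whiskering as an additive functor between Hom-categories\<close>

locale semiadditive_two_category = two_category +
  assumes loc: "locally_semiadditive C" and dist: "compositionally_distributive C"
begin

lemma semiadditive_hom_cat: "X \<in> Obj C \<Longrightarrow> Y \<in> Obj C \<Longrightarrow> semiadditive_category (hom_cat C X Y)"
  using loc category_hom_cat
  by (auto simp: locally_semiadditive_def semiadditive_category_def semiadditive_category_axioms_def)

lemma lwhisk_add:
  assumes "h \<in> Hom1 C Y Z" "\<alpha> \<in> Hom2 C f g" "\<beta> \<in> Hom2 C f g" "f \<in> Hom1 C X Y"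
  shows "h \<rhd> (\<alpha> \<boxplus> \<beta>) = (h \<rhd> \<alpha>) \<boxplus> (h \<rhd> \<beta>)"
proof -
  have "Id (Vert C) h \<in> Hom2 C h h" using assms(1) by (auto simp: Hom_def)
  with assms show ?thesis
    by (intro conjunct1[OF dist[unfolded compositionally_distributive_def], rule_format,
          where X = X and Y = Y and Z = Z and f = f and g = g and h = h and k = h]) blast
qed

lemma rwhisk_add:
  assumes "h \<in> Hom1 C X Y" "\<alpha> \<in> Hom2 C f g" "\<beta> \<in> Hom2 C f g" "f \<in> Hom1 C Y Z"
  shows "(\<alpha> \<boxplus> \<beta>) \<lhd> h = (\<alpha> \<lhd> h) \<boxplus> (\<beta> \<lhd> h)"
proof -
  have "Id (Vert C) h \<in> Hom2 C h h" using assms(1) by (auto simp: Hom_def)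
  with assms show ?thesis
    by (intro conjunct1[OF conjunct2[OF dist[unfolded compositionally_distributive_def]], rule_format,
          where X = X and Y = Y and Z = Z and f = f and g = g and h = h and k = h]) blast
qed

text \<open>Functoriality comes from the strict 2-category axioms. Sums and zeros are preserved by
  the binary and nullary clauses of distributivity, taken at the identity 2-morphism of
  \<open>h\<close>.\<close>

lemma lwhisk_additive:
  assumes X: "X \<in> Obj C" and h: "h \<in> Hom1 C Y Z"
  shows "additive_functor (hom_cat C X Y) (hom_cat C X Z) (\<lambda>f. h \<bullet> f) (\<lambda>\<alpha>. h \<rhd> \<alpha>)"
proof -
  have YZ: "Y \<in> Obj C" "Z \<in> Obj C" using one.Hom_objects[OF h] .
  have h2: "Id (Vert C) h \<in> Hom2 C h h" using h by (auto simp: Hom_def)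
  show ?thesis
  proof (intro additive_functor.intro additive_functor_axioms.intro)
    show "semiadditive_category (hom_cat C X Y)" "semiadditive_category (hom_cat C X Z)"
      using X YZ by (auto intro: semiadditive_hom_cat)
    show "h \<rhd> f \<in> Hom (hom_cat C X Z) (h \<bullet> a) (h \<bullet> b)" if "f \<in> Hom (hom_cat C X Y) a b" for f a b
      using that h unfolding Hom_hom_cat by (auto simp: Hom_def)
    show "h \<rhd> Id (hom_cat C X Y) a = Id (hom_cat C X Z) (h \<bullet> a)" if "a \<in> Ob (hom_cat C X Y)" for a
      using that h by (auto simp: Hom_def)
    show "h \<rhd> (g \<cdot>\<^bsub>hom_cat C X Y\<^esub> f) = (h \<rhd> g) \<cdot>\<^bsub>hom_cat C X Z\<^esub> (h \<rhd> f)"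
      if "f \<in> Hom (hom_cat C X Y) a b" "g \<in> Hom (hom_cat C X Y) b c" for f a b g c
      using that h unfolding Hom_hom_cat by (auto simp: Hom_def)
    show "h \<rhd> zero_mor (hom_cat C X Y) a b = zero_mor (hom_cat C X Z) (h \<bullet> a) (h \<bullet> b)"
      if ab: "a \<in> Ob (hom_cat C X Y)" "b \<in> Ob (hom_cat C X Y)" for a b
    proof -
      have "h \<rhd> zero2 C a b = zero2 C (h \<bullet> a) (h \<bullet> b)"
        using dist ab h h2 unfolding compositionally_distributive_def by simp
      then show ?thesis using ab h by (auto simp: zero2_def Hom_def)
    qed
    show "h \<rhd> add_mor (hom_cat C X Y) f g = add_mor (hom_cat C X Z) (h \<rhd> f) (h \<rhd> g)"
      if fg: "f \<in> Hom (hom_cat C X Y) a b" "g \<in> Hom (hom_cat C X Y) a b" for f a b g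
    proof -
      have "h \<rhd> (f \<boxplus> g) = (h \<rhd> f) \<boxplus> (h \<rhd> g)"
        using fg lwhisk_add[OF h] unfolding Hom_hom_cat by blast
      then show ?thesis using fg h unfolding Hom_hom_cat by (auto simp: add2_def Hom_def)
    qed
  qed
qed

lemma rwhisk_additive:
  assumes Z: "Z \<in> Obj C" and h: "h \<in> Hom1 C X Y"
  shows "additive_functor (hom_cat C Y Z) (hom_cat C X Z) (\<lambda>f. f \<bullet> h) (\<lambda>\<alpha>. \<alpha> \<lhd> h)"
proof -
  have XY: "X \<in> Obj C" "Y \<in> Obj C" using one.Hom_objects[OF h] .
  have h2: "Id (Vert C) h \<in> Hom2 C h h" using h by (auto simp: Hom_def)
  show ?thesis
  proof (intro additive_functor.intro additive_functor_axioms.intro)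
    show "semiadditive_category (hom_cat C Y Z)" "semiadditive_category (hom_cat C X Z)"
      using Z XY by (auto intro: semiadditive_hom_cat)
    show "f \<lhd> h \<in> Hom (hom_cat C X Z) (a \<bullet> h) (b \<bullet> h)" if "f \<in> Hom (hom_cat C Y Z) a b" for f a b
      using that h unfolding Hom_hom_cat by (auto simp: Hom_def)
    show "Id (hom_cat C Y Z) a \<lhd> h = Id (hom_cat C X Z) (a \<bullet> h)" if "a \<in> Ob (hom_cat C Y Z)" for a
      using that h by (auto simp: Hom_def)
    show "(g \<cdot>\<^bsub>hom_cat C Y Z\<^esub> f) \<lhd> h = (g \<lhd> h) \<cdot>\<^bsub>hom_cat C X Z\<^esub> (f \<lhd> h)"
      if "f \<in> Hom (hom_cat C Y Z) a b" "g \<in> Hom (hom_cat C Y Z) b c" for f a b g c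
      using that h unfolding Hom_hom_cat by (auto simp: Hom_def)
    show "zero_mor (hom_cat C Y Z) a b \<lhd> h = zero_mor (hom_cat C X Z) (a \<bullet> h) (b \<bullet> h)"
      if ab: "a \<in> Ob (hom_cat C Y Z)" "b \<in> Ob (hom_cat C Y Z)" for a b
    proof -
      have "zero2 C a b \<lhd> h = zero2 C (a \<bullet> h) (b \<bullet> h)"
        using dist ab h h2 unfolding compositionally_distributive_def by simp
      then show ?thesis using ab h by (auto simp: zero2_def Hom_def)
    qed
    show "add_mor (hom_cat C Y Z) f g \<lhd> h = add_mor (hom_cat C X Z) (f \<lhd> h) (g \<lhd> h)"
      if fg: "f \<in> Hom (hom_cat C Y Z) a b" "g \<in> Hom (hom_cat C Y Z) a b" for f a b g
    proof -
      have "(f \<boxplus> g) \<lhd> h = (f \<lhd> h) \<boxplus> (g \<lhd> h)"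
        using fg rwhisk_add[OF h] unfolding Hom_hom_cat by blast
      then show ?thesis using fg h unfolding Hom_hom_cat by (auto simp: add2_def Hom_def)
    qed
  qed
qed

end

section \<open>Weak 2-products in terms of Hom-categories\<close>

context two_category
begin

text \<open>Globularity places every 1-morphism parallel to \<open>s\<close> or \<open>a\<close> in
  the same Hom-category. The universal property can therefore be used with plain 2-morphisms,
  without membership conditions on \<open>x\<close>.\<close>

lemma hom_product:
  assumes "is_product (hom_cat C X Y) a b s p q"
  shows "s \<in> Hom1 C X Y" "a \<in> Hom1 C X Y" "b \<in> Hom1 C X Y" "p \<in> Hom2 C s a" "q \<in> Hom2 C s b"
    "\<And>f g x. \<lbrakk>f \<in> Hom2 C x a; g \<in> Hom2 C x b\<rbrakk> \<Longrightarrow> \<exists>h. h \<in> Hom2 C x s \<and> p \<odot> h = f \<and> q \<odot> h = g"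
    "\<And>h k x. \<lbrakk>h \<in> Hom2 C x s; k \<in> Hom2 C x s; p \<odot> h = p \<odot> k; q \<odot> h = q \<odot> k\<rbrakk> \<Longrightarrow> h = k"
proof -
  note P = category.is_productD[OF category_hom_cat assms, unfolded Hom_hom_cat hom_cat_simps]
  show s: "s \<in> Hom1 C X Y" and a: "a \<in> Hom1 C X Y" and "b \<in> Hom1 C X Y"
    and "p \<in> Hom2 C s a" "q \<in> Hom2 C s b"
    using P(1-3) by auto
  show "\<exists>h. h \<in> Hom2 C x s \<and> p \<odot> h = f \<and> q \<odot> h = g"
    if fg: "f \<in> Hom2 C x a" "g \<in> Hom2 C x b" for f g x
  proof -
    have "x \<in> Hom1 C X Y" using fg(1) a by (auto simp: Hom_def)
    then show ?thesis using P(2,3) P(4)[of f x g] fg by blast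
  qed
  show "h = k" if hk: "h \<in> Hom2 C x s" "k \<in> Hom2 C x s" "p \<odot> h = p \<odot> k" "q \<odot> h = q \<odot> k" for h k x
  proof -
    have "x \<in> Hom1 C X Y" using hk(1) s by (auto simp: Hom_def)
    then show ?thesis using P(5)[of h x k] hk s by blast
  qed
qed

lemma hom_product_zero:
  assumes "is_product (hom_cat C X Y) a b s p q" "is_zero_ob (hom_cat C X Y) b"
  shows "p \<in> Iso2 C s a"
  using category.is_product_zero_Isos[OF category_hom_cat assms] by (simp add: Isos_hom_cat)

lemma hom_zero_unique:
  assumes "is_zero_ob (hom_cat C X Y) z" "f \<in> Hom2 C z a" "g \<in> Hom2 C z a"
  shows "f = g"
proof -
  have "z \<in> Hom1 C X Y" using assms(1) by (simp add: is_zero_ob_def)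
  moreover from this have "a \<in> Hom1 C X Y" using assms(2) by (auto simp: Hom_def)
  ultimately show ?thesis
    using category.is_zero_ob_unique[OF category_hom_cat assms(1)] assms(2,3) by (simp add: Hom_hom_cat)
qed

text \<open>The cone data can be removed: choosing identities for the 2-isomorphisms of both cones
  turns the universal property into full faithfulness of composition with \<open>pA\<close> and
  \<open>pB\<close>, and conversely the conjugated 2-morphisms in the definition are particular
  choices of \<alpha> and \<beta>.\<close>

lemma weak_2product_iff:
  "weak_2product C A B P pA pB \<longleftrightarrow>
     P \<in> Obj C \<and> pA \<in> Hom1 C P A \<and> pB \<in> Hom1 C P B \<and>
     (\<forall>X \<in> Obj C. \<forall>f \<in> Hom1 C X A. \<forall>g \<in> Hom1 C X B.
        \<exists>b \<in> Hom1 C X P. (\<exists>\<xi>A. \<xi>A \<in> Iso2 C (pA \<bullet> b) f) \<and> (\<exists>\<xi>B. \<xi>B \<in> Iso2 C (pB \<bullet> b) g)) \<and>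
     (\<forall>X \<in> Obj C. \<forall>b \<in> Hom1 C X P. \<forall>b' \<in> Hom1 C X P.
        \<forall>\<alpha> \<in> Hom2 C (pA \<bullet> b) (pA \<bullet> b'). \<forall>\<beta> \<in> Hom2 C (pB \<bullet> b) (pB \<bullet> b').
        \<exists>!\<gamma>. \<gamma> \<in> Hom2 C b b' \<and> pA \<rhd> \<gamma> = \<alpha> \<and> pB \<rhd> \<gamma> = \<beta>)"
  (is "_ \<longleftrightarrow> ?P \<and> ?pA \<and> ?pB \<and> ?ES \<and> ?FF")
proof
  assume W: "weak_2product C A B P pA pB"
  then have P: ?P ?pA ?pB
    and ex: "\<forall>X \<in> Obj C. \<forall>f \<in> Hom1 C X A. \<forall>g \<in> Hom1 C X B.
        \<exists>b \<xi>A \<xi>B. weak_cone C A B P pA pB X f g b \<xi>A \<xi>B"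
    and un: "\<And>X f g b \<xi>A \<xi>B f' g' b' \<xi>A' \<xi>B' \<Sigma>A \<Sigma>B. \<lbrakk>X \<in> Obj C;
        weak_cone C A B P pA pB X f g b \<xi>A \<xi>B; weak_cone C A B P pA pB X f' g' b' \<xi>A' \<xi>B';
        \<Sigma>A \<in> Hom2 C f f'; \<Sigma>B \<in> Hom2 C g g'\<rbrakk> \<Longrightarrow>
        \<exists>!\<gamma>. \<gamma> \<in> Hom2 C b b' \<and> pA \<rhd> \<gamma> = inv2 C \<xi>A' \<odot> \<Sigma>A \<odot> \<xi>A \<and> pB \<rhd> \<gamma> = inv2 C \<xi>B' \<odot> \<Sigma>B \<odot> \<xi>B"
    unfolding weak_2product_def by simp_all
  have ?ES
  proof (intro ballI)
    fix X f g assume "X \<in> Obj C" "f \<in> Hom1 C X A" "g \<in> Hom1 C X B"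
    then obtain b \<xi>A \<xi>B where "weak_cone C A B P pA pB X f g b \<xi>A \<xi>B" using ex by blast
    then show "\<exists>b \<in> Hom1 C X P. (\<exists>\<xi>A. \<xi>A \<in> Iso2 C (pA \<bullet> b) f) \<and> (\<exists>\<xi>B. \<xi>B \<in> Iso2 C (pB \<bullet> b) g)"
      unfolding weak_cone_def by blast
  qed
  moreover have ?FF
  proof (intro ballI)
    fix X b b' \<alpha> \<beta>
    assume X: "X \<in> Obj C" and b: "b \<in> Hom1 C X P" "b' \<in> Hom1 C X P"
      and \<alpha>: "\<alpha> \<in> Hom2 C (pA \<bullet> b) (pA \<bullet> b')" and \<beta>: "\<beta> \<in> Hom2 C (pB \<bullet> b) (pB \<bullet> b')"
    \<comment> \<open>Every \<open>c\<close> into \<open>P\<close> is the mediating 1-morphism of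
      the cone of its own projections, with identity 2-isomorphisms.\<close>
    have cone: "weak_cone C A B P pA pB X (pA \<bullet> c) (pB \<bullet> c) c (Id (Vert C) (pA \<bullet> c)) (Id (Vert C) (pB \<bullet> c))"
      if "c \<in> Hom1 C X P" for c
      using that P(2,3) unfolding weak_cone_def by (auto intro!: vert.Id_Isos simp: Ob_Vert HomD) (auto simp: Hom_def)
    have "inv2 C (Id (Vert C) (pA \<bullet> b')) \<odot> \<alpha> \<odot> Id (Vert C) (pA \<bullet> b) = \<alpha>"
      "inv2 C (Id (Vert C) (pB \<bullet> b')) \<odot> \<beta> \<odot> Id (Vert C) (pB \<bullet> b) = \<beta>"
      using \<alpha> \<beta> P(2,3) b by (auto simp: vert.inverse_of_Id Ob_Vert Hom_def)
    then show "\<exists>!\<gamma>. \<gamma> \<in> Hom2 C b b' \<and> pA \<rhd> \<gamma> = \<alpha> \<and> pB \<rhd> \<gamma> = \<beta>"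
      using un[OF X cone[OF b(1)] cone[OF b(2)] \<alpha> \<beta>] by simp
  qed
  ultimately show "?P \<and> ?pA \<and> ?pB \<and> ?ES \<and> ?FF" using P by blast
next
  assume R: "?P \<and> ?pA \<and> ?pB \<and> ?ES \<and> ?FF"
  show "weak_2product C A B P pA pB"
    unfolding weak_2product_def
  proof (intro conjI ballI allI impI)
    show "\<exists>b \<xi>A \<xi>B. weak_cone C A B P pA pB X f g b \<xi>A \<xi>B"
      if X: "X \<in> Obj C" and f: "f \<in> Hom1 C X A" and g: "g \<in> Hom1 C X B" for X f g
    proof -
      from R have ?ES by blast
      then obtain b \<xi>A \<xi>B where "b \<in> Hom1 C X P" "\<xi>A \<in> Iso2 C (pA \<bullet> b) f" "\<xi>B \<in> Iso2 C (pB \<bullet> b) g"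
        using X f g by meson
      then show ?thesis using f g unfolding weak_cone_def by blast
    qed
  next
    fix X f g b \<xi>A \<xi>B f' g' b' \<xi>A' \<xi>B' \<Sigma>A \<Sigma>B
    assume X: "X \<in> Obj C" and H: "weak_cone C A B P pA pB X f g b \<xi>A \<xi>B \<and>
        weak_cone C A B P pA pB X f' g' b' \<xi>A' \<xi>B' \<and> \<Sigma>A \<in> Hom2 C f f' \<and> \<Sigma>B \<in> Hom2 C g g'"
    then have b: "b \<in> Hom1 C X P" "b' \<in> Hom1 C X P"
      and \<xi>: "\<xi>A \<in> Hom2 C (pA \<bullet> b) f" "\<xi>B \<in> Hom2 C (pB \<bullet> b) g"
      "\<xi>A' \<in> Iso2 C (pA \<bullet> b') f'" "\<xi>B' \<in> Iso2 C (pB \<bullet> b') g'"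
      unfolding weak_cone_def Isos_def by auto
    have "inv2 C \<xi>A' \<odot> \<Sigma>A \<odot> \<xi>A \<in> Hom2 C (pA \<bullet> b) (pA \<bullet> b')"
      "inv2 C \<xi>B' \<odot> \<Sigma>B \<odot> \<xi>B \<in> Hom2 C (pB \<bullet> b) (pB \<bullet> b')"
      using vert.inverse_of_Isos(1)[OF \<xi>(3)] vert.inverse_of_Isos(1)[OF \<xi>(4)] \<xi>(1,2) H vert.Comp_in
      by blast+
    moreover from R have ?FF by blast
    ultimately show "\<exists>!\<gamma>. \<gamma> \<in> Hom2 C b b' \<and> pA \<rhd> \<gamma> = inv2 C \<xi>A' \<odot> \<Sigma>A \<odot> \<xi>A \<and>
      pB \<rhd> \<gamma> = inv2 C \<xi>B' \<odot> \<Sigma>B \<odot> \<xi>B"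
      using X b by blast
  qed (use R in simp_all)
qed

end

context semiadditive_two_category
begin

lemma zero1: "X \<in> Obj C \<Longrightarrow> Y \<in> Obj C \<Longrightarrow> is_zero_ob (hom_cat C X Y) (zero1 C Y X)"
  unfolding zero1_def by (rule semiadditive_category.zero_ob[OF semiadditive_hom_cat])

lemma biprod1:
  assumes "f \<in> Hom1 C X Y" "g \<in> Hom1 C X Y"
  shows "is_biproduct (hom_cat C X Y) f g (biprod1 C f g)"
  using semiadditive_category.biprod[OF semiadditive_hom_cat, of X Y f g] assms one.Hom_objects[OF assms(1)]
  by (simp add: biprod1_def HomD)

lemma lwhisk_product:
  assumes "is_biproduct (hom_cat C X Y) a b S" "h \<in> Hom1 C Y Z"
  shows "is_product (hom_cat C X Z) (h \<bullet> a) (h \<bullet> b) (h \<bullet> Sum S) (h \<rhd> Pr1 S) (h \<rhd> Pr2 S)"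
proof -
  have "a \<in> Hom1 C X Y" using assms(1) by (auto simp: is_biproduct_def is_product_def Hom_hom_cat)
  then show ?thesis
    using additive_functor.F_product[OF lwhisk_additive[OF _ assms(2)] assms(1)] one.Hom_objects by blast
qed

lemma rwhisk_product:
  assumes "is_biproduct (hom_cat C Y Z) a b S" "h \<in> Hom1 C X Y"
  shows "is_product (hom_cat C X Z) (a \<bullet> h) (b \<bullet> h) (Sum S \<bullet> h) (Pr1 S \<lhd> h) (Pr2 S \<lhd> h)"
proof -
  have "a \<in> Hom1 C Y Z" using assms(1) by (auto simp: is_biproduct_def is_product_def Hom_hom_cat)
  then show ?thesis
    using additive_functor.F_product[OF rwhisk_additive[OF _ assms(2)] assms(1)] one.Hom_objects by blast
qed

lemma rwhisk_zero:
  assumes "is_zero_ob (hom_cat C Y Z) z" "h \<in> Hom1 C X Y"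
  shows "is_zero_ob (hom_cat C X Z) (z \<bullet> h)"
proof -
  have "z \<in> Hom1 C Y Z" using assms(1) by (auto simp: is_zero_ob_def)
  then show ?thesis
    using additive_functor.F_zero_ob[OF rwhisk_additive[OF _ assms(2)] assms(1)] one.Hom_objects by blast
qed

section \<open>From weak 2-biproducts to weak 2-products\<close>

text \<open>Whiskering by \<open>pA\<close> keeps the product decomposition, and the second summand
  \<open>pA \<bullet> iB \<bullet> g\<close> becomes zero, so the first projection is invertible.
  For general \<open>f\<close> and \<open>g\<close> this provides the cone over them; for
  \<open>f = pA\<close> and \<open>g = pB\<close> it provides the comparison with
  \<open>pA \<rhd> \<theta>P\<close>.\<close>

lemma proj_iso:
  assumes pA: "pA \<in> Hom1 C P A" and iA: "iA \<in> Hom1 C A P" and iB: "iB \<in> Hom1 C B P"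
    and z: "is_zero_ob (hom_cat C B A) (pA \<bullet> iB)"
    and f: "f \<in> Hom1 C X A" and g: "g \<in> Hom1 C X B"
    and S: "is_biproduct (hom_cat C X P) (iA \<bullet> f) (iB \<bullet> g) S"
    and \<theta>A: "\<theta>A \<in> Iso2 C (pA \<bullet> iA) (Id (One C) A)"
  shows "(\<theta>A \<lhd> f) \<odot> (pA \<rhd> Pr1 S) \<in> Iso2 C (pA \<bullet> Sum S) f"
proof -
  have T: "(pA \<bullet> iA) \<bullet> f = pA \<bullet> iA \<bullet> f" "(pA \<bullet> iB) \<bullet> g = pA \<bullet> iB \<bullet> g" "Id (One C) A \<bullet> f = f"
    using pA iA iB f g by (auto simp: Hom_def)
  have "is_zero_ob (hom_cat C X A) (pA \<bullet> iB \<bullet> g)"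
    using rwhisk_zero[OF z g] T by simp
  then have "pA \<rhd> Pr1 S \<in> Iso2 C (pA \<bullet> Sum S) (pA \<bullet> iA \<bullet> f)"
    by (rule hom_product_zero[OF lwhisk_product[OF S pA]])
  moreover have "\<theta>A \<lhd> f \<in> Iso2 C (pA \<bullet> iA \<bullet> f) f"
    using rwhisk_Isos[OF \<theta>A f one.Comp_in[OF iA pA]] T by simp
  ultimately show ?thesis by (rule vert.Comp_Isos)
qed

text \<open>The two sides differ by an automorphism \<open>\<psi>\<close> of \<open>p\<^sub>A\<close>. The hypothesis makes \<open>\<psi> i\<^sub>A\<close> trivial, and \<open>\<psi> i\<^sub>B\<close>
  is trivial because \<open>p\<^sub>A i\<^sub>B\<close> is zero; hence so is \<open>\<psi> (i\<^sub>A p\<^sub>A \<oplus> i\<^sub>B p\<^sub>B)\<close>, and \<open>\<psi>\<close> itself as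
  \<open>i\<^sub>A p\<^sub>A \<oplus> i\<^sub>B p\<^sub>B \<cong> id\<close>.\<close>

lemma lwhisk_biproduct_iso:
  assumes pA: "pA \<in> Hom1 C P A" and iA: "iA \<in> Hom1 C A P"
    and pB: "pB \<in> Hom1 C P B" and iB: "iB \<in> Hom1 C B P"
    and z: "is_zero_ob (hom_cat C B A) (pA \<bullet> iB)"
    and S: "is_biproduct (hom_cat C P P) (iA \<bullet> pA) (iB \<bullet> pB) S"
    and \<theta>A: "\<theta>A \<in> Iso2 C (pA \<bullet> iA) (Id (One C) A)"
    and \<theta>P: "\<theta>P \<in> Iso2 C (Sum S) (Id (One C) P)"
    and eq: "pA \<rhd> \<theta>P \<lhd> iA = ((pA \<bullet> iA) \<rhd> \<theta>A) \<odot> (pA \<rhd> Pr1 S \<lhd> iA)"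
  shows "pA \<rhd> \<theta>P = (\<theta>A \<lhd> pA) \<odot> (pA \<rhd> Pr1 S)"
proof -
  define s p q where spq: "s = Sum S" "p = Pr1 S" "q = Pr2 S"
  note prod = lwhisk_product[OF S pA, folded spq]
  have S': "is_product (hom_cat C P P) (iA \<bullet> pA) (iB \<bullet> pB) s p q"
    using S by (simp add: is_biproduct_def spq)
  note H = hom_product[OF S']
  have \<theta>A': "\<theta>A \<in> Hom2 C (pA \<bullet> iA) (Id (One C) A)" and \<theta>P': "\<theta>P \<in> Hom2 C s (Id (One C) P)"
    using \<theta>A \<theta>P by (auto simp: Isos_def spq)
  note T = HomD[OF pA] HomD[OF iA] HomD[OF pB] HomD[OF iB] HomD[OF H(1)] HomD[OF H(4)] HomD[OF H(5)]
    HomD[OF \<theta>A'] HomD[OF \<theta>P'] one.Hom_objects[OF pA] one.Hom_objects[OF iB]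
  define \<chi> where "\<chi> = (\<theta>A \<lhd> pA) \<odot> (pA \<rhd> p)"
  have \<chi>: "\<chi> \<in> Iso2 C (pA \<bullet> s) pA"
    using proj_iso[OF pA iA iB z pA pB S \<theta>A] by (simp add: \<chi>_def spq)
  then obtain \<chi>' where \<chi>': "\<chi> \<in> Hom2 C (pA \<bullet> s) pA" "\<chi>' \<in> Hom2 C pA (pA \<bullet> s)" "\<chi>' \<odot> \<chi> = Id (Vert C) (pA \<bullet> s)"
    by (rule vert.IsosE)
  note T\<chi> = HomD[OF \<chi>'(1)] HomD[OF \<chi>'(2)]
  define \<psi> where "\<psi> = (pA \<rhd> \<theta>P) \<odot> \<chi>'"
  have \<psi>: "\<psi> \<in> Hom2 C pA pA" unfolding \<psi>_def by (simp add: Hom_def T T\<chi>)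
  note T\<psi> = HomD[OF \<psi>]
  have \<psi>\<chi>: "\<psi> \<odot> \<chi> = pA \<rhd> \<theta>P" unfolding \<psi>_def by (simp add: T T\<chi> \<chi>'(3))
  have "\<chi> \<lhd> iA = (\<theta>A \<lhd> (pA \<bullet> iA)) \<odot> (pA \<rhd> p \<lhd> iA)" unfolding \<chi>_def by (simp add: T)
  \<comment> \<open>The hypothesis whiskers \<theta>A from the left, \<chi> from the right; the two
    agree because \<theta>A is a 2-isomorphism to an identity.\<close>
  then have "\<chi> \<lhd> iA = (pA \<rhd> \<theta>P) \<lhd> iA"
    using eq lwhisk_eq_rwhisk_iso[OF \<theta>A one.Comp_in[OF iA pA]] by (simp add: T spq[symmetric])
  then have eqA: "(\<psi> \<lhd> iA) \<odot> (\<chi> \<lhd> iA) = Id (Vert C) (pA \<bullet> iA) \<odot> (\<chi> \<lhd> iA)"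
    unfolding \<psi>\<chi>[symmetric] by (simp add: T T\<chi> T\<psi>)
  have A: "\<psi> \<lhd> iA = Id (Vert C) (pA \<bullet> iA)"
  proof (rule vert.iso_cancel_right[OF _ _ _ eqA])
    show "\<chi> \<lhd> iA \<in> Iso2 C ((pA \<bullet> s) \<bullet> iA) (pA \<bullet> iA)"
      by (rule rwhisk_Isos[OF \<chi> iA one.Comp_in[OF H(1) pA]])
  qed (simp_all add: Hom_def T T\<psi>)
  have B: "\<psi> \<lhd> iB = Id (Vert C) (pA \<bullet> iB)"
    by (rule hom_zero_unique[OF z, of _ "pA \<bullet> iB"]) (auto simp: Hom_def T T\<psi>)
  \<comment> \<open>As \<open>pA \<bullet> s\<close> is a product, the equation is tested after
    \<open>pA \<rhd> p\<close> and \<open>pA \<rhd> q\<close>. The exchange law moves \<psi> past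
    these projections, leaving its whiskerings by \<open>iA \<bullet> pA\<close> and
    \<open>iB \<bullet> pB\<close>, which are trivial by \<open>A\<close> and
    \<open>B\<close>.\<close>
  have "\<psi> \<lhd> s = Id (Vert C) (pA \<bullet> s)"
  proof (rule hom_product(7)[OF prod, of _ "pA \<bullet> s"])
    have "\<psi> \<lhd> (iA \<bullet> pA) = Id (Vert C) (pA \<bullet> iA \<bullet> pA)"
      using arg_cong[OF A, of "\<lambda>\<alpha>. \<alpha> \<lhd> pA"] by (simp add: T T\<psi>)
    then show "(pA \<rhd> p) \<odot> (\<psi> \<lhd> s) = (pA \<rhd> p) \<odot> Id (Vert C) (pA \<bullet> s)"
      using whisk_exchange[of p \<psi>] by (simp add: T T\<psi>)
    have "\<psi> \<lhd> (iB \<bullet> pB) = Id (Vert C) (pA \<bullet> iB \<bullet> pB)"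
      using arg_cong[OF B, of "\<lambda>\<alpha>. \<alpha> \<lhd> pB"] by (simp add: T T\<psi>)
    then show "(pA \<rhd> q) \<odot> (\<psi> \<lhd> s) = (pA \<rhd> q) \<odot> Id (Vert C) (pA \<bullet> s)"
      using whisk_exchange[of q \<psi>] by (simp add: T T\<psi>)
  qed (auto simp: Hom_def T T\<psi>)
  \<comment> \<open>Exchanging \<psi> with \<theta>P replaces the left side by
    \<open>(pA \<rhd> \<theta>P) \<odot> (\<psi> \<lhd> s)\<close>.\<close>
  then have "\<psi> \<odot> (pA \<rhd> \<theta>P) = Id (Vert C) pA \<odot> (pA \<rhd> \<theta>P)"
    using whisk_exchange[of \<theta>P \<psi>] by (simp add: T T\<psi>)
  moreover have "pA \<rhd> \<theta>P \<in> Iso2 C (pA \<bullet> s) pA"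
    using lwhisk_Isos[OF \<theta>P pA H(1)[unfolded spq]] by (simp add: T spq[symmetric])
  ultimately have "\<psi> = Id (Vert C) pA"
    using vert.iso_cancel_right[OF _ \<psi> vert.Id_in] T(1) by (simp add: Ob_Vert)
  then show ?thesis using \<psi>\<chi> unfolding \<chi>_def spq[symmetric] by (simp add: T)
qed

text \<open>Here \<delta> is the 2-morphism on \<open>s\<close> corresponding to \<gamma> under
  \<theta>P, and its first component is \<open>iA \<rhd> \<alpha>\<close>. Applying
  \<open>pA\<close>, inserting the formula for \<open>pA \<rhd> \<theta>P\<close> and moving
  \<alpha> past \<theta>A leaves a common 2-isomorphism to cancel. Only one projection is mentioned,
  so the lemma serves for \<open>A\<close> and for \<open>B\<close>.\<close>

lemma lwhisk_transport:
  assumes pA: "pA \<in> Hom1 C P A" and iA: "iA \<in> Hom1 C A P"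
    and s: "s \<in> Hom1 C P P" and p: "p \<in> Hom2 C s (iA \<bullet> pA)"
    and \<theta>A: "\<theta>A \<in> Hom2 C (pA \<bullet> iA) (Id (One C) A)"
    and \<theta>P: "\<theta>P \<in> Iso2 C s (Id (One C) P)"
    and eq: "pA \<rhd> \<theta>P = (\<theta>A \<lhd> pA) \<odot> (pA \<rhd> p)"
    and b: "b \<in> Hom1 C X P" "b' \<in> Hom1 C X P"
    and \<alpha>: "\<alpha> \<in> Hom2 C (pA \<bullet> b) (pA \<bullet> b')" and \<gamma>: "\<gamma> \<in> Hom2 C b b'" and \<delta>: "\<delta> \<in> Hom2 C (s \<bullet> b) (s \<bullet> b')"
    and \<gamma>\<delta>: "\<gamma> \<odot> (\<theta>P \<lhd> b) = (\<theta>P \<lhd> b') \<odot> \<delta>"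
    and \<delta>\<alpha>: "(p \<lhd> b') \<odot> \<delta> = (iA \<rhd> \<alpha>) \<odot> (p \<lhd> b)"
  shows "pA \<rhd> \<gamma> = \<alpha>"
proof -
  have \<theta>P': "\<theta>P \<in> Hom2 C s (Id (One C) P)" using \<theta>P by (auto simp: Isos_def)
  note T = HomD[OF pA] HomD[OF iA] HomD[OF s] HomD[OF p] HomD[OF b(1)] HomD[OF b(2)] HomD[OF \<alpha>]
    HomD[OF \<gamma>] HomD[OF \<delta>] HomD[OF \<theta>A] HomD[OF \<theta>P'] one.Hom_objects[OF pA]
  have eqb: "pA \<rhd> \<theta>P \<lhd> c = (\<theta>A \<lhd> (pA \<bullet> c)) \<odot> (pA \<rhd> p \<lhd> c)" if c: "c \<in> Hom1 C X P" for c
    using arg_cong[OF eq, of "\<lambda>\<alpha>. \<alpha> \<lhd> c"] HomD[OF c] by (simp add: T)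
  have "(pA \<rhd> \<gamma>) \<odot> (pA \<rhd> \<theta>P \<lhd> b) = (pA \<rhd> \<theta>P \<lhd> b') \<odot> (pA \<rhd> \<delta>)"
    using arg_cong[OF \<gamma>\<delta>, of "\<lambda>\<alpha>. pA \<rhd> \<alpha>"] by (simp add: T)
  also have "\<dots> = (\<theta>A \<lhd> (pA \<bullet> b')) \<odot> (pA \<rhd> ((p \<lhd> b') \<odot> \<delta>))"
    unfolding eqb[OF b(2)] by (simp add: T)
  also have "\<dots> = (\<theta>A \<lhd> (pA \<bullet> b')) \<odot> ((pA \<bullet> iA) \<rhd> \<alpha>) \<odot> (pA \<rhd> p \<lhd> b)"
    unfolding \<delta>\<alpha> by (simp add: T)
  also have "\<dots> = ((\<theta>A \<lhd> (pA \<bullet> b')) \<odot> ((pA \<bullet> iA) \<rhd> \<alpha>)) \<odot> (pA \<rhd> p \<lhd> b)"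
    by (simp add: T)
  also have "\<dots> = (\<alpha> \<odot> (\<theta>A \<lhd> (pA \<bullet> b))) \<odot> (pA \<rhd> p \<lhd> b)"
    using whisk_exchange[of \<alpha> \<theta>A] by (simp add: T)
  also have "\<dots> = \<alpha> \<odot> (pA \<rhd> \<theta>P \<lhd> b)"
    unfolding eqb[OF b(1)] by (simp add: T)
  finally have eq: "(pA \<rhd> \<gamma>) \<odot> (pA \<rhd> \<theta>P \<lhd> b) = \<alpha> \<odot> (pA \<rhd> \<theta>P \<lhd> b)" .
  have iso: "pA \<rhd> \<theta>P \<lhd> b \<in> Iso2 C (pA \<bullet> s \<bullet> b) (pA \<bullet> b)"
    using lwhisk_Isos[OF rwhisk_Isos[OF \<theta>P b(1) s] pA one.Comp_in[OF b(1) s]] by (simp add: T)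
  have "pA \<rhd> \<gamma> \<in> Hom2 C (pA \<bullet> b) (pA \<bullet> b')" by (simp add: Hom_def T)
  then show ?thesis using vert.iso_cancel_right[OF iso _ \<alpha> eq] by simp
qed

lemma biproduct_fully_faithful:
  assumes pA: "pA \<in> Hom1 C P A" and iA: "iA \<in> Hom1 C A P"
    and pB: "pB \<in> Hom1 C P B" and iB: "iB \<in> Hom1 C B P"
    and S: "is_biproduct (hom_cat C P P) (iA \<bullet> pA) (iB \<bullet> pB) S"
    and \<theta>A: "\<theta>A \<in> Hom2 C (pA \<bullet> iA) (Id (One C) A)"
    and \<theta>B: "\<theta>B \<in> Hom2 C (pB \<bullet> iB) (Id (One C) B)"
    and \<theta>P: "\<theta>P \<in> Iso2 C (Sum S) (Id (One C) P)"
    and eqA: "pA \<rhd> \<theta>P = (\<theta>A \<lhd> pA) \<odot> (pA \<rhd> Pr1 S)"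
    and eqB: "pB \<rhd> \<theta>P = (\<theta>B \<lhd> pB) \<odot> (pB \<rhd> Pr2 S)"
    and b: "b \<in> Hom1 C X P" "b' \<in> Hom1 C X P"
    and \<alpha>: "\<alpha> \<in> Hom2 C (pA \<bullet> b) (pA \<bullet> b')" and \<beta>: "\<beta> \<in> Hom2 C (pB \<bullet> b) (pB \<bullet> b')"
  shows "\<exists>!\<gamma>. \<gamma> \<in> Hom2 C b b' \<and> pA \<rhd> \<gamma> = \<alpha> \<and> pB \<rhd> \<gamma> = \<beta>"
proof -
  define s p q where spq: "s = Sum S" "p = Pr1 S" "q = Pr2 S"
  have S': "is_product (hom_cat C P P) (iA \<bullet> pA) (iB \<bullet> pB) s p q"
    using S by (simp add: is_biproduct_def spq)
  note H = hom_product[OF S']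
  note prod = rwhisk_product[OF S b(2), folded spq]
  note \<theta>P = \<theta>P[folded spq] and eqA = eqA[folded spq] and eqB = eqB[folded spq]
  have \<theta>P': "\<theta>P \<in> Hom2 C s (Id (One C) P)" using \<theta>P by (auto simp: Isos_def)
  note T = HomD[OF pA] HomD[OF iA] HomD[OF pB] HomD[OF iB] HomD[OF H(1)] HomD[OF H(4)] HomD[OF H(5)]
    HomD[OF \<theta>A] HomD[OF \<theta>B] HomD[OF \<theta>P'] HomD[OF b(1)] HomD[OF b(2)] HomD[OF \<alpha>] HomD[OF \<beta>]
    one.Hom_objects[OF pA] one.Hom_objects[OF iB]
  have "(iA \<rhd> \<alpha>) \<odot> (p \<lhd> b) \<in> Hom2 C (s \<bullet> b) ((iA \<bullet> pA) \<bullet> b')"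
    "(iB \<rhd> \<beta>) \<odot> (q \<lhd> b) \<in> Hom2 C (s \<bullet> b) ((iB \<bullet> pB) \<bullet> b')"
    by (simp_all add: Hom_def T)
  \<comment> \<open>\<delta> is the direct sum of \<open>iA \<rhd> \<alpha>\<close> and
    \<open>iB \<rhd> \<beta>\<close>, formed in the product that whiskering by \<open>b'\<close>
    preserves.\<close>
  from hom_product(6)[OF prod this] obtain \<delta> where \<delta>: "\<delta> \<in> Hom2 C (s \<bullet> b) (s \<bullet> b')"
    and \<delta>\<alpha>: "(p \<lhd> b') \<odot> \<delta> = (iA \<rhd> \<alpha>) \<odot> (p \<lhd> b)" and \<delta>\<beta>: "(q \<lhd> b') \<odot> \<delta> = (iB \<rhd> \<beta>) \<odot> (q \<lhd> b)"
    by blast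
  have \<theta>b: "\<theta>P \<lhd> b \<in> Iso2 C (s \<bullet> b) b" using rwhisk_Isos[OF \<theta>P b(1) H(1)] by (simp add: T)
  then obtain \<epsilon> where \<epsilon>: "\<epsilon> \<in> Hom2 C b (s \<bullet> b)" "\<epsilon> \<odot> (\<theta>P \<lhd> b) = Id (Vert C) (s \<bullet> b)"
    by (rule vert.IsosE)
  note T' = T HomD[OF \<delta>] HomD[OF \<epsilon>(1)]
  define \<gamma> where "\<gamma> = (\<theta>P \<lhd> b') \<odot> \<delta> \<odot> \<epsilon>"
  have \<gamma>: "\<gamma> \<in> Hom2 C b b'" unfolding \<gamma>_def by (simp add: Hom_def T')
  have \<gamma>\<delta>: "\<gamma> \<odot> (\<theta>P \<lhd> b) = (\<theta>P \<lhd> b') \<odot> \<delta>" unfolding \<gamma>_def by (simp add: T' \<epsilon>(2))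
  show ?thesis
  proof
    show "\<gamma> \<in> Hom2 C b b' \<and> pA \<rhd> \<gamma> = \<alpha> \<and> pB \<rhd> \<gamma> = \<beta>"
      using \<gamma> lwhisk_transport[OF pA iA H(1,4) \<theta>A \<theta>P eqA b \<alpha> \<gamma> \<delta> \<gamma>\<delta> \<delta>\<alpha>]
        lwhisk_transport[OF pB iB H(1,5) \<theta>B \<theta>P eqB b \<beta> \<gamma> \<delta> \<gamma>\<delta> \<delta>\<beta>] by simp
    show "\<kappa> = \<gamma>" if \<kappa>: "\<kappa> \<in> Hom2 C b b' \<and> pA \<rhd> \<kappa> = \<alpha> \<and> pB \<rhd> \<kappa> = \<beta>" for \<kappa>
    proof -
      from \<kappa> have \<kappa>2: "\<kappa> \<in> Hom2 C b b'" by blast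
      note T\<kappa> = HomD[OF \<kappa>2]
      have "iA \<rhd> \<alpha> = iA \<rhd> (pA \<rhd> \<kappa>)" "iB \<rhd> \<beta> = iB \<rhd> (pB \<rhd> \<kappa>)"
        using \<kappa> by simp_all
      then have e: "iA \<rhd> \<alpha> = (iA \<bullet> pA) \<rhd> \<kappa>" "iB \<rhd> \<beta> = (iB \<bullet> pB) \<rhd> \<kappa>"
        by (simp_all add: T T\<kappa>)
      \<comment> \<open>A competitor \<kappa> is determined by \<open>s \<rhd> \<kappa>\<close>,
        since \<theta>P identifies \<open>s\<close> with the identity. The components of
        \<open>s \<rhd> \<kappa>\<close> are found by exchanging \<kappa> with the projections of
        \<open>s\<close>.\<close>
      have "s \<rhd> \<kappa> = \<delta>"
      proof (rule hom_product(7)[OF prod _ \<delta>])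
        show "s \<rhd> \<kappa> \<in> Hom2 C (s \<bullet> b) (s \<bullet> b')" by (simp add: Hom_def T T\<kappa>)
        show "(p \<lhd> b') \<odot> (s \<rhd> \<kappa>) = (p \<lhd> b') \<odot> \<delta>"
          unfolding \<delta>\<alpha> e using whisk_exchange[of \<kappa> p] by (simp add: T T\<kappa>)
        show "(q \<lhd> b') \<odot> (s \<rhd> \<kappa>) = (q \<lhd> b') \<odot> \<delta>"
          unfolding \<delta>\<beta> e using whisk_exchange[of \<kappa> q] by (simp add: T T\<kappa>)
      qed
      then have "\<kappa> \<odot> (\<theta>P \<lhd> b) = \<gamma> \<odot> (\<theta>P \<lhd> b)"
        unfolding \<gamma>\<delta> using whisk_exchange[of \<kappa> \<theta>P] by (simp add: T T\<kappa>)
      then show "\<kappa> = \<gamma>" by (rule vert.iso_cancel_right[OF \<theta>b \<kappa>2 \<gamma>])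
    qed
  qed
qed

lemma weak_2biproduct_imp_weak_2product:
  assumes W: "weak_2biproduct C A B P pA pB iA iB \<theta>A \<theta>B \<theta>AB \<theta>BA \<theta>P"
  shows "weak_2product C A B P pA pB"
proof -
  define S where "S = biprod1 C (iA \<bullet> pA) (iB \<bullet> pB)"
  have P: "P \<in> Obj C" and pA: "pA \<in> Hom1 C P A" and pB: "pB \<in> Hom1 C P B"
    and iA: "iA \<in> Hom1 C A P" and iB: "iB \<in> Hom1 C B P"
    and \<theta>A: "\<theta>A \<in> Iso2 C (pA \<bullet> iA) (Id (One C) A)" and \<theta>B: "\<theta>B \<in> Iso2 C (pB \<bullet> iB) (Id (One C) B)"
    and \<theta>BA: "\<theta>BA \<in> Iso2 C (pB \<bullet> iA) (zero1 C B A)" and \<theta>AB: "\<theta>AB \<in> Iso2 C (pA \<bullet> iB) (zero1 C A B)"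
    and \<theta>P: "\<theta>P \<in> Iso2 C (Sum S) (Id (One C) P)"
    and eqA: "pA \<rhd> \<theta>P \<lhd> iA = ((pA \<bullet> iA) \<rhd> \<theta>A) \<odot> (pA \<rhd> Pr1 S \<lhd> iA)"
    and eqB: "pB \<rhd> \<theta>P \<lhd> iB = ((pB \<bullet> iB) \<rhd> \<theta>B) \<odot> (pB \<rhd> Pr2 S \<lhd> iB)"
    using W unfolding weak_2biproduct_def Let_def S_def[symmetric] by auto
  have A: "A \<in> Obj C" and B: "B \<in> Obj C" using one.Hom_objects iA iB by blast+
  have zAB: "is_zero_ob (hom_cat C B A) (pA \<bullet> iB)"
    using category.is_zero_ob_iso[OF category_hom_cat zero1[OF B A]] \<theta>AB one.Comp_in[OF iB pA] zero1[OF B A]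
    by (auto simp: Isos_hom_cat is_zero_ob_def)
  have zBA: "is_zero_ob (hom_cat C A B) (pB \<bullet> iA)"
    using category.is_zero_ob_iso[OF category_hom_cat zero1[OF A B]] \<theta>BA one.Comp_in[OF iA pB] zero1[OF A B]
    by (auto simp: Isos_hom_cat is_zero_ob_def)
  have S: "is_biproduct (hom_cat C P P) (iA \<bullet> pA) (iB \<bullet> pB) S"
    unfolding S_def by (rule biprod1[OF one.Comp_in[OF pA iA] one.Comp_in[OF pB iB]])
  note swap = category.is_biproduct_swap[OF category_hom_cat]
  have eqA': "pA \<rhd> \<theta>P = (\<theta>A \<lhd> pA) \<odot> (pA \<rhd> Pr1 S)"
    by (rule lwhisk_biproduct_iso[OF pA iA pB iB zAB S \<theta>A \<theta>P eqA])
  have eqB': "pB \<rhd> \<theta>P = (\<theta>B \<lhd> pB) \<odot> (pB \<rhd> Pr2 S)"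
    using lwhisk_biproduct_iso[OF pB iB pA iA zBA swap[OF S] \<theta>B] \<theta>P eqB by (simp add: swap_biprod_def)
  have es: "\<exists>b \<in> Hom1 C X P. (\<exists>\<xi>A. \<xi>A \<in> Iso2 C (pA \<bullet> b) f) \<and> (\<exists>\<xi>B. \<xi>B \<in> Iso2 C (pB \<bullet> b) g)"
    if f: "f \<in> Hom1 C X A" and g: "g \<in> Hom1 C X B" for X f g
  proof -
    \<comment> \<open>The cone over \<open>f\<close> and \<open>g\<close> is carried by the sum of
      \<open>iA \<bullet> f\<close> and \<open>iB \<bullet> g\<close>; \<open>proj_iso\<close>
      identifies its two projections.\<close>
    define R where "R = biprod1 C (iA \<bullet> f) (iB \<bullet> g)"
    have R: "is_biproduct (hom_cat C X P) (iA \<bullet> f) (iB \<bullet> g) R"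
      unfolding R_def by (rule biprod1[OF one.Comp_in[OF f iA] one.Comp_in[OF g iB]])
    then have "Sum R \<in> Hom1 C X P" by (simp add: is_biproduct_def is_product_def)
    then show ?thesis
      using proj_iso[OF pA iA iB zAB f g R \<theta>A] proj_iso[OF pB iB iA zBA g f swap[OF R] \<theta>B]
      by (auto simp: swap_biprod_def)
  qed
  have "\<theta>A \<in> Hom2 C (pA \<bullet> iA) (Id (One C) A)" "\<theta>B \<in> Hom2 C (pB \<bullet> iB) (Id (One C) B)"
    using \<theta>A \<theta>B by (auto simp: Isos_def)
  note ff = biproduct_fully_faithful[OF pA iA pB iB S this \<theta>P eqA' eqB']
  show ?thesis
    unfolding weak_2product_iff by (intro conjI ballI P pA pB es ff)
qed

section \<open>From weak 2-products to weak 2-biproducts\<close>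

text \<open>The inverses of \<open>pA \<rhd> \<gamma>\<close> and \<open>pB \<rhd> \<gamma>\<close>
  lift jointly to a 2-morphism \<delta>, and both composites of \<gamma> and \<delta> lift
  identities.\<close>

lemma fully_faithful_reflects_iso:
  assumes pA: "pA \<in> Hom1 C P A" and pB: "pB \<in> Hom1 C P B"
    and ff: "\<And>b b' \<alpha> \<beta>. \<lbrakk>b \<in> Hom1 C X P; b' \<in> Hom1 C X P;
        \<alpha> \<in> Hom2 C (pA \<bullet> b) (pA \<bullet> b'); \<beta> \<in> Hom2 C (pB \<bullet> b) (pB \<bullet> b')\<rbrakk>
        \<Longrightarrow> \<exists>!\<gamma>. \<gamma> \<in> Hom2 C b b' \<and> pA \<rhd> \<gamma> = \<alpha> \<and> pB \<rhd> \<gamma> = \<beta>"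
    and b: "b \<in> Hom1 C X P" "b' \<in> Hom1 C X P" and \<gamma>: "\<gamma> \<in> Hom2 C b b'"
    and iso: "pA \<rhd> \<gamma> \<in> Iso2 C (pA \<bullet> b) (pA \<bullet> b')" "pB \<rhd> \<gamma> \<in> Iso2 C (pB \<bullet> b) (pB \<bullet> b')"
  shows "\<gamma> \<in> Iso2 C b b'"
proof -
  obtain \<alpha> where \<alpha>: "\<alpha> \<in> Hom2 C (pA \<bullet> b') (pA \<bullet> b)"
    "\<alpha> \<odot> (pA \<rhd> \<gamma>) = Id (Vert C) (pA \<bullet> b)" "(pA \<rhd> \<gamma>) \<odot> \<alpha> = Id (Vert C) (pA \<bullet> b')"
    using iso(1) by (rule vert.IsosE)
  obtain \<beta> where \<beta>: "\<beta> \<in> Hom2 C (pB \<bullet> b') (pB \<bullet> b)"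
    "\<beta> \<odot> (pB \<rhd> \<gamma>) = Id (Vert C) (pB \<bullet> b)" "(pB \<rhd> \<gamma>) \<odot> \<beta> = Id (Vert C) (pB \<bullet> b')"
    using iso(2) by (rule vert.IsosE)
  obtain \<delta> where \<delta>: "\<delta> \<in> Hom2 C b' b" "pA \<rhd> \<delta> = \<alpha>" "pB \<rhd> \<delta> = \<beta>"
    using ex1_implies_ex[OF ff[OF b(2,1) \<alpha>(1) \<beta>(1)]] by auto
  note T = HomD[OF pA] HomD[OF pB] HomD[OF b(1)] HomD[OF b(2)] HomD[OF \<gamma>] HomD[OF \<delta>(1)]
  \<comment> \<open>The identity of \<open>c\<close> lifts the two identities as well, so uniqueness
    of lifts forces \<eta> to be that identity.\<close>
  have unique: "\<eta> = Id (Vert C) c" if c: "c \<in> Hom1 C X P" and \<eta>: "\<eta> \<in> Hom2 C c c"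
    and eq: "pA \<rhd> \<eta> = Id (Vert C) (pA \<bullet> c)" "pB \<rhd> \<eta> = Id (Vert C) (pB \<bullet> c)" for c \<eta>
  proof -
    have Ic: "Id (Vert C) c \<in> Hom2 C c c" "pA \<rhd> Id (Vert C) c = Id (Vert C) (pA \<bullet> c)"
      "pB \<rhd> Id (Vert C) c = Id (Vert C) (pB \<bullet> c)"
      using HomD[OF c] T by (simp_all add: Hom_def)
    have "Id (Vert C) (pA \<bullet> c) \<in> Hom2 C (pA \<bullet> c) (pA \<bullet> c)" "Id (Vert C) (pB \<bullet> c) \<in> Hom2 C (pB \<bullet> c) (pB \<bullet> c)"
      using HomD[OF c] T by (simp_all add: Hom_def)
    from ex1_implies_ex[OF ff[OF c c this]] ff[OF c c this] show ?thesis
      using Ic \<eta> eq by auto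
  qed
  have "\<delta> \<odot> \<gamma> = Id (Vert C) b"
    by (rule unique[OF b(1)]) (use \<alpha> \<beta> \<delta> in \<open>simp_all add: Hom_def T\<close>)
  moreover have "\<gamma> \<odot> \<delta> = Id (Vert C) b'"
    by (rule unique[OF b(2)]) (use \<alpha> \<beta> \<delta> in \<open>simp_all add: Hom_def T\<close>)
  ultimately show ?thesis using \<gamma> \<delta>(1) by (intro vert.IsosI)
qed

lemma weak_2product_imp_weak_2biproduct:
  assumes A: "A \<in> Obj C" and B: "B \<in> Obj C" and W: "weak_2product C A B P pA pB"
  shows "\<exists>iA iB \<theta>A \<theta>B \<theta>AB \<theta>BA \<theta>P. weak_2biproduct C A B P pA pB iA iB \<theta>A \<theta>B \<theta>AB \<theta>BA \<theta>P"
proof -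
  have P: "P \<in> Obj C" and pA: "pA \<in> Hom1 C P A" and pB: "pB \<in> Hom1 C P B"
    and es: "\<And>X f g. \<lbrakk>X \<in> Obj C; f \<in> Hom1 C X A; g \<in> Hom1 C X B\<rbrakk> \<Longrightarrow>
        \<exists>b \<in> Hom1 C X P. (\<exists>\<xi>A. \<xi>A \<in> Iso2 C (pA \<bullet> b) f) \<and> (\<exists>\<xi>B. \<xi>B \<in> Iso2 C (pB \<bullet> b) g)"
    and ff: "\<And>X b b' \<alpha> \<beta>. \<lbrakk>X \<in> Obj C; b \<in> Hom1 C X P; b' \<in> Hom1 C X P;
        \<alpha> \<in> Hom2 C (pA \<bullet> b) (pA \<bullet> b'); \<beta> \<in> Hom2 C (pB \<bullet> b) (pB \<bullet> b')\<rbrakk>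
        \<Longrightarrow> \<exists>!\<gamma>. \<gamma> \<in> Hom2 C b b' \<and> pA \<rhd> \<gamma> = \<alpha> \<and> pB \<rhd> \<gamma> = \<beta>"
    using W unfolding weak_2product_iff by simp_all
  note zAB = zero1[OF B A] and zBA = zero1[OF A B]
  have z1: "zero1 C A B \<in> Hom1 C B A" "zero1 C B A \<in> Hom1 C A B"
    using zAB zBA by (simp_all add: is_zero_ob_def)
  obtain iA \<theta>A \<theta>BA where iA: "iA \<in> Hom1 C A P" and \<theta>A: "\<theta>A \<in> Iso2 C (pA \<bullet> iA) (Id (One C) A)"
    and \<theta>BA: "\<theta>BA \<in> Iso2 C (pB \<bullet> iA) (zero1 C B A)"
    using es[OF A one.Id_in[OF A] z1(2)] by blast
  obtain iB \<theta>B \<theta>AB where iB: "iB \<in> Hom1 C B P" and \<theta>AB: "\<theta>AB \<in> Iso2 C (pA \<bullet> iB) (zero1 C A B)"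
    and \<theta>B: "\<theta>B \<in> Iso2 C (pB \<bullet> iB) (Id (One C) B)"
    using es[OF B z1(1) one.Id_in[OF B]] by blast
  have \<theta>': "\<theta>A \<in> Hom2 C (pA \<bullet> iA) (Id (One C) A)" "\<theta>B \<in> Hom2 C (pB \<bullet> iB) (Id (One C) B)"
    using \<theta>A \<theta>B by (auto simp: Isos_def)
  have zAB': "is_zero_ob (hom_cat C B A) (pA \<bullet> iB)"
    using category.is_zero_ob_iso[OF category_hom_cat zAB] \<theta>AB one.Comp_in[OF iB pA] z1
    by (simp add: Isos_hom_cat)
  have zBA': "is_zero_ob (hom_cat C A B) (pB \<bullet> iA)"
    using category.is_zero_ob_iso[OF category_hom_cat zBA] \<theta>BA one.Comp_in[OF iA pB] z1
    by (simp add: Isos_hom_cat)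
  define S where "S = biprod1 C (iA \<bullet> pA) (iB \<bullet> pB)"
  have S: "is_biproduct (hom_cat C P P) (iA \<bullet> pA) (iB \<bullet> pB) S"
    unfolding S_def by (rule biprod1[OF one.Comp_in[OF pA iA] one.Comp_in[OF pB iB]])
  then have S': "is_product (hom_cat C P P) (iA \<bullet> pA) (iB \<bullet> pB) (Sum S) (Pr1 S) (Pr2 S)"
    by (simp add: is_biproduct_def)
  note H = hom_product[OF S']
  have isoA: "(\<theta>A \<lhd> pA) \<odot> (pA \<rhd> Pr1 S) \<in> Iso2 C (pA \<bullet> Sum S) pA"
    by (rule proj_iso[OF pA iA iB zAB' pA pB S \<theta>A])
  have isoB: "(\<theta>B \<lhd> pB) \<odot> (pB \<rhd> Pr2 S) \<in> Iso2 C (pB \<bullet> Sum S) pB"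
    using proj_iso[OF pB iB iA zBA' pB pA category.is_biproduct_swap[OF category_hom_cat S] \<theta>B]
    by (simp add: swap_biprod_def)
  note T = HomD[OF pA] HomD[OF iA] HomD[OF pB] HomD[OF iB] HomD[OF H(1)] HomD[OF H(4)] HomD[OF H(5)]
    HomD[OF \<theta>'(1)] HomD[OF \<theta>'(2)]
  have idP: "pA \<bullet> Id (One C) P = pA" "pB \<bullet> Id (One C) P = pB" by (simp_all add: T)
  have "\<exists>!\<theta>. \<theta> \<in> Hom2 C (Sum S) (Id (One C) P) \<and>
      pA \<rhd> \<theta> = (\<theta>A \<lhd> pA) \<odot> (pA \<rhd> Pr1 S) \<and> pB \<rhd> \<theta> = (\<theta>B \<lhd> pB) \<odot> (pB \<rhd> Pr2 S)"
    using isoA isoB by (intro ff[OF P H(1) one.Id_in[OF P]]) (simp_all add: idP Isos_def)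
  then obtain \<theta>P where \<theta>P: "\<theta>P \<in> Hom2 C (Sum S) (Id (One C) P)"
    and eqA: "pA \<rhd> \<theta>P = (\<theta>A \<lhd> pA) \<odot> (pA \<rhd> Pr1 S)"
    and eqB: "pB \<rhd> \<theta>P = (\<theta>B \<lhd> pB) \<odot> (pB \<rhd> Pr2 S)"
    by (auto dest!: ex1_implies_ex)
  \<comment> \<open>Both whiskerings of \<theta>P are the 2-isomorphisms \<open>isoA\<close> and
    \<open>isoB\<close>, and invertibility is reflected.\<close>
  have \<theta>Piso: "\<theta>P \<in> Iso2 C (Sum S) (Id (One C) P)"
    by (rule fully_faithful_reflects_iso[OF pA pB ff[OF P] H(1) one.Id_in[OF P] \<theta>P])
      (simp_all add: idP eqA eqB isoA isoB)
  note T = T HomD[OF \<theta>P]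
  have "pA \<rhd> \<theta>P \<lhd> iA = (\<theta>A \<lhd> (pA \<bullet> iA)) \<odot> (pA \<rhd> Pr1 S \<lhd> iA)"
    using arg_cong[OF eqA, of "\<lambda>\<alpha>. \<alpha> \<lhd> iA"] by (simp add: T P)
  moreover have "pB \<rhd> \<theta>P \<lhd> iB = (\<theta>B \<lhd> (pB \<bullet> iB)) \<odot> (pB \<rhd> Pr2 S \<lhd> iB)"
    using arg_cong[OF eqB, of "\<lambda>\<alpha>. \<alpha> \<lhd> iB"] by (simp add: T P)
  ultimately have "weak_2biproduct C A B P pA pB iA iB \<theta>A \<theta>B \<theta>AB \<theta>BA \<theta>P"
    using P pA pB iA iB \<theta>A \<theta>B \<theta>AB \<theta>BA \<theta>Piso
      lwhisk_eq_rwhisk_iso[OF \<theta>A one.Comp_in[OF iA pA]] lwhisk_eq_rwhisk_iso[OF \<theta>B one.Comp_in[OF iB pB]]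
    unfolding weak_2biproduct_def Let_def S_def[symmetric] by simp
  then show ?thesis by blast
qed

lemma weak_2product_iff_weak_2biproduct:
  assumes "A \<in> Obj C" "B \<in> Obj C"
  shows "(\<exists>P pA pB. weak_2product C A B P pA pB) \<longleftrightarrow>
    (\<exists>P pA pB iA iB \<theta>A \<theta>B \<theta>AB \<theta>BA \<theta>P. weak_2biproduct C A B P pA pB iA iB \<theta>A \<theta>B \<theta>AB \<theta>BA \<theta>P)"
  using weak_2product_imp_weak_2biproduct[OF assms] weak_2biproduct_imp_weak_2product by meson

end

section \<open>Duality\<close>

lemma op_two_cat_simps [simp]:
  "One (op_two_cat C) = op_cat (One C)" "Vert (op_two_cat C) = Vert C"
  "HComp (op_two_cat C) \<beta> \<alpha> = HComp C \<alpha> \<beta>"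
  by (simp_all add: op_two_cat_def)

lemma op_op_two_cat: "op_two_cat (op_two_cat C) = C"
  by (simp add: op_two_cat_def op_cat_def)

lemma hom_cat_op [simp]: "hom_cat (op_two_cat C) X Y = hom_cat C Y X"
  by (simp add: hom_cat_def)

lemma horiz_op: "horiz (op_two_cat C) = \<lparr>Ob = Obj C, Ar = Ar (Vert C),
     Dom = (\<lambda>\<alpha>. Cod (One C) (Dom (Vert C) \<alpha>)),
     Cod = (\<lambda>\<alpha>. Dom (One C) (Dom (Vert C) \<alpha>)),
     Id = (\<lambda>X. Id (Vert C) (Id (One C) X)),
     Comp = (\<lambda>\<beta> \<alpha>. HComp C \<alpha> \<beta>)\<rparr>"
  by (simp add: horiz_def op_two_cat_def op_cat_def)

lemma category_op:
  assumes "category K"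
  shows "category (op_cat K)"
proof -
  interpret category K by (rule assms)
  show ?thesis
    by unfold_locales (auto simp: Dom_in Cod_in Id_in Comp_in Id_left Id_right Comp_assoc)
qed

lemma zero2_op: "zero2 (op_two_cat C) f g = zero2 C f g"
  by (simp add: zero2_def)

lemma zero1_op: "zero1 (op_two_cat C) Y X = zero1 C X Y"
  by (simp add: zero1_def)

lemma biprod1_op: "biprod1 (op_two_cat C) f g = biprod1 C f g"
  by (simp add: biprod1_def)

lemma add2_op: "add2 (op_two_cat C) \<alpha> \<beta> = add2 C \<alpha> \<beta>"
  by (simp add: add2_def)

context semiadditive_two_category
begin

text \<open>Reversing 1-morphisms leaves vertical composition alone and replaces
  \<open>horiz C\<close> by its opposite category.\<close>

lemma op_two_category: "two_category (op_two_cat C)"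
proof (rule two_category.intro)
  have "horiz (op_two_cat C) = op_cat (horiz C)"
    unfolding horiz_op by (simp add: horiz_def op_cat_def)
  then show "category (horiz (op_two_cat C))" using category_op[OF category_horiz] by simp
qed (use category_op[OF category_One] category_Vert Ob_Vert globular HComp_in HComp_Id interchange in \<open>simp_all\<close>)

lemma op_semiadditive_two_category: "semiadditive_two_category (op_two_cat C)"
proof (intro semiadditive_two_category.intro semiadditive_two_category_axioms.intro)
  show "two_category (op_two_cat C)" by (rule op_two_category)
  show "locally_semiadditive (op_two_cat C)" using loc by (simp add: locally_semiadditive_def)
  show "compositionally_distributive (op_two_cat C)"
  proof -
    note D = dist[unfolded compositionally_distributive_def]
    \<comment> \<open>Left and right distributivity trade places, in the binary and in the nullary
      case; the vertical clause stays as it is.\<close>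
    show ?thesis
      unfolding compositionally_distributive_def zero2_op add2_op op_two_cat_simps op_cat_simps
      apply (intro conjI)
      subgoal by (intro allI impI, rule D[THEN conjunct2, THEN conjunct1, rule_format]) blast
      subgoal by (intro allI impI, rule D[THEN conjunct1, rule_format]) blast
      subgoal by (rule D[THEN conjunct2, THEN conjunct2, THEN conjunct1])
      subgoal by (intro allI impI, rule D[THEN conjunct2, THEN conjunct2, THEN conjunct2, THEN conjunct2, rule_format]) blast
      subgoal by (intro allI impI, rule D[THEN conjunct2, THEN conjunct2, THEN conjunct2, THEN conjunct1, rule_format]) blast
      done
  qed
qed

text \<open>Projections and injections are exchanged, and with them \<theta>AB and \<theta>BA. The
  composites \<open>iA \<bullet> pA\<close> and \<open>iB \<bullet> pB\<close>, hence their sum and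
  \<theta>P, are unchanged. The matrix conditions differ only in the side from which \<theta>A and
  \<theta>B are whiskered, which \<open>lwhisk_eq_rwhisk_iso\<close> reconciles.\<close>

lemma weak_2biproduct_op:
  assumes W: "weak_2biproduct C A B P pA pB iA iB \<theta>A \<theta>B \<theta>AB \<theta>BA \<theta>P"
  shows "weak_2biproduct (op_two_cat C) A B P iA iB pA pB \<theta>A \<theta>B \<theta>BA \<theta>AB \<theta>P"
proof -
  define S where "S = biprod1 C (iA \<bullet> pA) (iB \<bullet> pB)"
  have P: "P \<in> Obj C" and pA: "pA \<in> Hom1 C P A" and pB: "pB \<in> Hom1 C P B"
    and iA: "iA \<in> Hom1 C A P" and iB: "iB \<in> Hom1 C B P"
    and \<theta>A: "\<theta>A \<in> Iso2 C (pA \<bullet> iA) (Id (One C) A)" and \<theta>B: "\<theta>B \<in> Iso2 C (pB \<bullet> iB) (Id (One C) B)"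
    and "\<theta>P \<in> Iso2 C (Sum S) (Id (One C) P)"
    and eqA: "pA \<rhd> \<theta>P \<lhd> iA = ((pA \<bullet> iA) \<rhd> \<theta>A) \<odot> (pA \<rhd> Pr1 S \<lhd> iA)"
    and eqB: "pB \<rhd> \<theta>P \<lhd> iB = ((pB \<bullet> iB) \<rhd> \<theta>B) \<odot> (pB \<rhd> Pr2 S \<lhd> iB)"
    using W unfolding weak_2biproduct_def Let_def S_def[symmetric] by auto
  then have \<theta>P: "\<theta>P \<in> Hom2 C (Sum S) (Id (One C) P)" by (simp add: Isos_def)
  have "is_product (hom_cat C P P) (iA \<bullet> pA) (iB \<bullet> pB) (Sum S) (Pr1 S) (Pr2 S)"
    using biprod1[OF one.Comp_in[OF pA iA] one.Comp_in[OF pB iB]] by (simp add: is_biproduct_def S_def)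
  note H = hom_product[OF this]
  note T = HomD[OF pA] HomD[OF iA] HomD[OF pB] HomD[OF iB] HomD[OF H(1)] HomD[OF H(4)] HomD[OF H(5)]
    HomD[OF \<theta>P]
  show ?thesis
    unfolding weak_2biproduct_def Let_def
    using W T eqA eqB lwhisk_eq_rwhisk_iso[OF \<theta>A one.Comp_in[OF iA pA]]
      lwhisk_eq_rwhisk_iso[OF \<theta>B one.Comp_in[OF iB pB]]
    by (simp add: weak_2biproduct_def Let_def S_def[symmetric] biprod1_op zero1_op)
qed

end

theorem theorem1:
  fixes C :: "('o, 'm, 'c) two_cat" and A B :: 'o
  assumes "two_category C"
    and "locally_semiadditive C"
    and "compositionally_distributive C"
    and "A \<in> Obj C" and "B \<in> Obj C"
  shows "((\<exists>P pA pB. weak_2product C A B P pA pB)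
            \<longleftrightarrow> (\<exists>P iA iB. weak_2coproduct C A B P iA iB))
       \<and> ((\<exists>P iA iB. weak_2coproduct C A B P iA iB)
            \<longleftrightarrow> (\<exists>P pA pB iA iB \<theta>A \<theta>B \<theta>AB \<theta>BA \<theta>P.
                   weak_2biproduct C A B P pA pB iA iB \<theta>A \<theta>B \<theta>AB \<theta>BA \<theta>P))"
proof -
  interpret C: semiadditive_two_category C
    using assms(1-3) by (intro semiadditive_two_category.intro semiadditive_two_category_axioms.intro)
  interpret op: semiadditive_two_category "op_two_cat C"
    by (rule C.op_semiadditive_two_category)
  \<comment> \<open>Both directions are the same lemma, applied to \<open>C\<close> and to its dual,
    as the double dual is \<open>C\<close> itself. Weak 2-coproducts are weak 2-products of the
    dual, so the equivalence already proved applies to them there.\<close>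
  have "(\<exists>P pA pB iA iB \<theta>A \<theta>B \<theta>AB \<theta>BA \<theta>P.
          weak_2biproduct (op_two_cat C) A B P pA pB iA iB \<theta>A \<theta>B \<theta>AB \<theta>BA \<theta>P) \<longleftrightarrow>
        (\<exists>P pA pB iA iB \<theta>A \<theta>B \<theta>AB \<theta>BA \<theta>P.
          weak_2biproduct C A B P pA pB iA iB \<theta>A \<theta>B \<theta>AB \<theta>BA \<theta>P)"
    using C.weak_2biproduct_op op.weak_2biproduct_op unfolding op_op_two_cat by meson
  then show ?thesis
    using C.weak_2product_iff_weak_2biproduct op.weak_2product_iff_weak_2biproduct assms(4,5)
    by (simp add: weak_2coproduct_def)
qed

end
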